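(* Let $\mathbf{B}$ be the interaction matrix of a $q$-spin system and $\Delta\geq3$. Under the correspondence $\alpha_i=R_i^{\Delta/(\Delta-1)}/\sum_{i'}R_{i'}^{\Delta/(\Delta-1)}$, $\beta_j=C_j^{\Delta/(\Delta-1)}/\sum_{j'}C_{j'}^{\Delta/(\Delta-1)}$ between fixpoints $(\mathbf{r},\mathbf{c})$ of the tree recursions and critical points $(\boldsymbol{\alpha},\boldsymbol{\beta})$ of $\Psi_1$, Jacobian attractive fixpoints of the tree recursions (considered as the map $(R_1,\dots,R_q,C_1,\dots,C_q)\mapsto(\hat R_1,\dots,\hat R_q,\hat C_1,\dots,\hat C_q)$) correspond to Hessian local maxima of $\Psi_1$.
   Context: $\mathbf{B}=(B_{ij})$ is a symmetric $q\times q$ nonnegative matrix (irreducible, standing assumption). The tree recursions are $\hat R_i\propto(\sum_jB_{ij}C_j)^{\Delta-1}$, $\hat C_j\propto(\sum_iB_{ij}R_i)^{\Delta-1}$, considered in projective space (each of $\mathbf{r}$ and $\mathbf{c}$ up to positive scaling); a fixpoint satisfies $\hat R_i\propto R_i$, $\hat C_j\propto C_j$. A fixpoint of a map $f$ is Jacobian attractive if the Jacobian of $f$ at it (here: of the induced map on projective space, i.e., excluding the directions that rescale $\mathbf{r}$ or $\mathbf{c}$) has spectral radius less than $1$. $\Psi_1$ is defined on pairs of probability vectors by $\Psi_1(\boldsymbol{\alpha},\boldsymbol{\beta})=\max_{\mathbf{x}}[(\Delta-1)(\sum_i\alpha_i\ln\alpha_i+\sum_j\beta_j\ln\beta_j)+\Delta\sum_{i,j}x_{ij}(\ln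 B_{ij}-\ln x_{ij})]$ over nonnegative $\mathbf{x}\in\mathbb{R}^{q\times q}$ with $\sum_jx_{ij}=\alpha_i$, $\sum_ix_{ij}=\beta_j$ (conventions $\ln0=-\infty$, $0\ln0=0$). A critical point of $\Psi_1$ (in the subspace $\sum_i\alpha_i=\sum_j\beta_j=1$) is a Hessian local maximum if the Hessian of $\Psi_1$ there, restricted to directions preserving these constraints, is negative definite. *)

theory Defs
  imports "HOL-Analysis.Analysis"
begin

definition nonneg_sym_mat :: "real^'q^'q \<Rightarrow> bool" where
  "nonneg_sym_mat B \<longleftrightarrow> (\<forall>i j. B$i$j \<ge> 0 \<and> B$i$j = B$j$i)"

definition irreducible_mat :: "real^'q^'q \<Rightarrow> bool" where
  "irreducible_mat B \<longleftrightarrow> (\<forall>i j. (i, j) \<in> {(a, b). B$a$b \<noteq> 0}\<^sup>+)"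

definition xlnx :: "real \<Rightarrow> real" where
  "xlnx t = (if t = 0 then 0 else t * ln t)"

text \<open>Objective of Psi_1 for a given matrix x, with the conventions ln 0 = -infinity
  and 0 ln 0 = 0: a term x_ij (ln B_ij - ln x_ij) equals 0 if x_ij = 0, and equals
  -infinity if x_ij > 0 = B_ij.\<close>
definition psi1_obj :: "real^'q^'q \<Rightarrow> real \<Rightarrow> real^'q \<Rightarrow> real^'q \<Rightarrow> real^'q^'q \<Rightarrow> ereal" where
  "psi1_obj B D \<alpha> \<beta> x =
     (if (\<exists>i j. B$i$j = 0 \<and> x$i$j \<noteq> 0) then -\<infinity>
      else ereal ((D - 1) * ((\<Sum>i\<in>UNIV. xlnx (\<alpha>$i)) + (\<Sum>j\<in>UNIV. xlnx (\<beta>$j)))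
                  + D * (\<Sum>i\<in>UNIV. \<Sum>j\<in>UNIV.
                          (if x$i$j = 0 then 0 else x$i$j * (ln (B$i$j) - ln (x$i$j))))))"

definition psi1_feasible :: "real^'q \<Rightarrow> real^'q \<Rightarrow> (real^'q^'q) set" where
  "psi1_feasible \<alpha> \<beta> = {x. (\<forall>i j. x$i$j \<ge> 0) \<and> (\<forall>i. (\<Sum>j\<in>UNIV. x$i$j) = \<alpha>$i)
                              \<and> (\<forall>j. (\<Sum>i\<in>UNIV. x$i$j) = \<beta>$j)}"

text \<open>Psi_1 (extended-real valued; the maximum over the compact feasible set is its supremum,
  and the value is -infinity when no x gives a finite objective).\<close>
definition Psi1 :: "real^'q^'q \<Rightarrow> real \<Rightarrow> real^'q \<Rightarrow> real^'q \<Rightarrow> ereal" where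
  "Psi1 B D \<alpha> \<beta> = (SUP x\<in>psi1_feasible \<alpha> \<beta>. psi1_obj B D \<alpha> \<beta> x)"

text \<open>Directions preserving sum alpha = sum beta = 1.\<close>
definition constr_dirs :: "((real^'q) \<times> (real^'q)) set" where
  "constr_dirs = {(a, b). (\<Sum>i\<in>UNIV. a$i) = 0 \<and> (\<Sum>j\<in>UNIV. b$j) = 0}"

text \<open>(alpha, beta) is a critical point of Psi_1 (restricted to the constraint plane) at which
  Psi_1 is twice differentiable (on the plane) with negative definite Hessian on the
  constraint directions. g is Psi_1 near (alpha,beta) on the plane, G a gradient field of g
  (w.r.t. directions in the plane), H the derivative of G at (alpha,beta); the Hessian
  bilinear form is (u,v) |-> H u . v.\<close>
definition hessian_local_max :: "real^'q^'q \<Rightarrow> real \<Rightarrow> real^'q \<Rightarrow> real^'q \<Rightarrow> bool" where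
  "hessian_local_max B D \<alpha> \<beta> \<longleftrightarrow>
     (\<exists>\<epsilon>>0. \<exists>(g :: (real^'q) \<times> (real^'q) \<Rightarrow> real) G H.
        (\<forall>h\<in>constr_dirs. norm h < \<epsilon> \<longrightarrow> Psi1 B D (\<alpha> + fst h) (\<beta> + snd h) = ereal (g h)) \<and>
        (\<forall>h\<in>constr_dirs. norm h < \<epsilon> \<longrightarrow> (g has_derivative (\<lambda>v. G h \<bullet> v)) (at h within constr_dirs)) \<and>
        (G has_derivative H) (at 0 within constr_dirs) \<and>
        (\<forall>v\<in>constr_dirs. G 0 \<bullet> v = 0) \<and>
        (\<forall>v\<in>constr_dirs. v \<noteq> 0 \<longrightarrow> H v \<bullet> v < 0))"

definition tree_rec :: "real^'q^'q \<Rightarrow> nat \<Rightarrow> (real^'q) \<times> (real^'q) \<Rightarrow> (real^'q) \<times> (real^'q)" where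
  "tree_rec B \<Delta> p =
     ((\<chi> i. (\<Sum>j\<in>UNIV. B$i$j * snd p $ j) ^ (\<Delta> - 1)),
      (\<chi> j. (\<Sum>i\<in>UNIV. B$i$j * fst p $ i) ^ (\<Delta> - 1)))"

definition normalize_vec :: "real^'q \<Rightarrow> real^'q" where
  "normalize_vec v = (1 / (\<Sum>i\<in>UNIV. v$i)) *\<^sub>R v"

text \<open>The induced map on projective space, in the chart sum r = sum c = 1.\<close>
definition proj_tree_rec :: "real^'q^'q \<Rightarrow> nat \<Rightarrow> (real^'q) \<times> (real^'q) \<Rightarrow> (real^'q) \<times> (real^'q)" where
  "proj_tree_rec B \<Delta> p = (normalize_vec (fst (tree_rec B \<Delta> p)), normalize_vec (snd (tree_rec B \<Delta> p)))"

definition is_fixpoint :: "real^'q^'q \<Rightarrow> nat \<Rightarrow> real^'q \<Rightarrow> real^'q \<Rightarrow> bool" where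
  "is_fixpoint B \<Delta> R C \<longleftrightarrow>
     (\<exists>k>0. fst (tree_rec B \<Delta> (R, C)) = k *\<^sub>R R) \<and> (\<exists>k>0. snd (tree_rec B \<Delta> (R, C)) = k *\<^sub>R C)"

text \<open>Complex eigenvalues of a real linear map L restricted to an invariant subspace S
  (eigenvalues of the complexification: L(u + i v) = z (u + i v)).\<close>
definition cplx_eigenvalue_on :: "('a::real_vector \<Rightarrow> 'a) \<Rightarrow> 'a set \<Rightarrow> complex \<Rightarrow> bool" where
  "cplx_eigenvalue_on L S z \<longleftrightarrow>
     (\<exists>u\<in>S. \<exists>v\<in>S. (u \<noteq> 0 \<or> v \<noteq> 0) \<and>
        L u = Re z *\<^sub>R u - Im z *\<^sub>R v \<and> L v = Im z *\<^sub>R u + Re z *\<^sub>R v)"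

text \<open>Spectral radius (0 for the map on the zero space).\<close>
definition spectral_radius_on :: "('a::real_vector \<Rightarrow> 'a) \<Rightarrow> 'a set \<Rightarrow> real" where
  "spectral_radius_on L S = Sup (insert 0 {cmod z | z. cplx_eigenvalue_on L S z})"

text \<open>Jacobian attractive: the Jacobian of the projective map at the fixpoint (represented by
  its normalised representative), restricted to the tangent directions of the chart
  (i.e. excluding the rescaling directions), has spectral radius < 1.\<close>
definition jacobian_attractive :: "real^'q^'q \<Rightarrow> nat \<Rightarrow> real^'q \<Rightarrow> real^'q \<Rightarrow> bool" where
  "jacobian_attractive B \<Delta> R C \<longleftrightarrow>
     (\<exists>L. (proj_tree_rec B \<Delta> has_derivative L) (at (normalize_vec R, normalize_vec C)) \<and>
          spectral_radius_on L constr_dirs < 1)"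

definition corr_vec :: "nat \<Rightarrow> real^'q \<Rightarrow> real^'q" where
  "corr_vec \<Delta> R = (\<chi> i. R$i powr (real \<Delta> / (real \<Delta> - 1))
                          / (\<Sum>i'\<in>UNIV. R$i' powr (real \<Delta> / (real \<Delta> - 1))))"

end

theory Submission
  imports Defs
begin

text \<open>
  At a fixpoint, \<open>x\<^sub>i\<^sub>j = R\<^sub>i B\<^sub>i\<^sub>j C\<^sub>j / Z\<close> is a coupling of \<open>\<alpha>\<close> and \<open>\<beta>\<close>. Let \<open>A\<close> be multiplication by
  \<open>(\<alpha>, \<beta>)\<close>, \<open>T (\<rho>, \<gamma>) = (x \<gamma>, x\<^sup>T \<rho>)\<close>, and \<open>K = A\<^sup>-\<^sup>1 T\<close>, which is self-adjoint for the inner product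
  given by \<open>A\<close> and has symmetric spectrum. In logarithmic coordinates the projective Jacobian is
  \<open>(\<Delta> - 1) K\<close> on mean-zero pairs, so attractiveness means \<open>\<bar>k\<bar> (\<Delta> - 1) < 1\<close> for each eigenvalue \<open>k\<close>.

  Up to a constant, the inner maximum in \<open>\<Psi>\<^sub>1\<close> is minus the Legendre transform of \<open>\<Sum> B\<^sub>i\<^sub>j exp (\<rho>\<^sub>i + \<gamma>\<^sub>j)\<close>, whose
  Hessian is \<open>A + T\<close>. Hence the Hessian of \<open>\<Psi>\<^sub>1\<close> is \<open>(\<Delta> - 1) A\<^sup>-\<^sup>1 - \<Delta> (A + T)\<^sup>-\<^sup>1\<close>, and it is
  negative definite iff \<open>((\<Delta> - 1) k - 1) (k + 1) < 0\<close> for each \<open>k\<close>, which by symmetry of the spectrum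
  is the same condition. If \<open>-1\<close> is an eigenvalue on mean-zero pairs, both properties fail.
\<close>

section \<open>Self-adjoint pencils\<close>

text \<open>Along \<open>p + t w\<close> the form is \<open>2 t b + t^2 a\<close>, without constant
  term; it stays nonnegative for all \<open>t\<close> only if \<open>b = 0\<close>. Applied to
  \<open>\<sigma> A - T\<close>, this makes a maximiser of the Rayleigh quotient a stationary
  point.\<close>

lemma psd_form_zero:
  fixes F :: "'a::real_inner \<Rightarrow> 'a"
  assumes F: "linear F" and sym: "\<And>x y. F x \<bullet> y = x \<bullet> F y"
    and W: "subspace W" and psd: "\<And>x. x \<in> W \<Longrightarrow> 0 \<le> F x \<bullet> x"
    and p: "p \<in> W" "F p \<bullet> p = 0" and w: "w \<in> W"
  shows "F p \<bullet> w = 0"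
proof -
  define a b where "a = F w \<bullet> w" and "b = F p \<bullet> w"
  have ge: "0 \<le> 2 * t * b + t\<^sup>2 * a" for t
  proof -
    have "p + t *\<^sub>R w \<in> W"
      using p w W by (simp add: subspace_add subspace_scale)
    moreover have "F (p + t *\<^sub>R w) \<bullet> (p + t *\<^sub>R w) = 2 * t * b + t\<^sup>2 * a"
      using p(2) sym[of w p]
      by (simp add: linear_add[OF F] linear_scale[OF F] inner_add_left inner_add_right
          a_def b_def power2_eq_square inner_commute)
    ultimately show ?thesis
      using psd by metis
  qed
  have a: "0 \<le> a"
    using psd[OF w] by (simp add: a_def)
  \<comment> \<open>The added 1 avoids division by zero when \<open>a = 0\<close>, and the form
    still becomes \<open>- t^2 (a + 2)\<close>, negative unless \<open>t = 0\<close>.\<close>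
  define t where "t = - b / (a + 1)"
  have b: "b = - t * (a + 1)"
    using a by (simp add: t_def)
  have "0 \<le> - (t\<^sup>2 * (a + 2))"
    using ge[of t] by (simp add: b algebra_simps power2_eq_square)
  moreover have "0 \<le> t\<^sup>2 * (a + 2)"
    using a by simp
  ultimately have "t\<^sup>2 * (a + 2) = 0"
    by linarith
  then have "t = 0"
    using a by simp
  then show ?thesis
    using b by (simp add: b_def)
qed

text \<open>The isometry \<open>J\<close> anticommutes with \<open>T\<close>, so the spectrum of the pencil is symmetric about 0 and
  one-sided bounds on eigenvalues are two-sided.\<close>

locale sym_pencil =
  fixes A T K J :: "'a::euclidean_space \<Rightarrow> 'a" and W :: "'a set"
  assumes linear_A: "linear A" and linear_T: "linear T" and linear_J: "linear J"
    and sym_A: "A x \<bullet> y = x \<bullet> A y" and sym_T: "T x \<bullet> y = x \<bullet> T y"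
    and pos_A: "x \<noteq> 0 \<Longrightarrow> A x \<bullet> x > 0"
    and subspace_W: "subspace W"
    and A_K: "A (K x) = T x" and K_in_W: "x \<in> W \<Longrightarrow> K x \<in> W"
    and J_in_W: "x \<in> W \<Longrightarrow> J x \<in> W" and A_J: "A (J x) = J (A x)" and T_J: "T (J x) = - J (T x)"
    and inner_J: "J x \<bullet> J y = x \<bullet> y"
begin

section \<open>Eigenvectors of the pencil and the Rayleigh quotient\<close>

definition eigpair :: "real \<Rightarrow> 'a \<Rightarrow> bool" where
  "eigpair k p \<longleftrightarrow> p \<in> W \<and> p \<noteq> 0 \<and> T p = k *\<^sub>R A p"

text \<open>The quotient of the two forms attains its maximum on the unit sphere of
  \<open>W\<close>. Stationarity is known only against test vectors in \<open>W\<close>; since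
  \<open>K\<close> preserves \<open>W\<close>, this suffices for the full equation
  \<open>T p = \<sigma> A p\<close>.\<close>

lemma rayleigh:
  assumes "w0 \<in> W" "w0 \<noteq> 0"
  obtains \<sigma> p where "eigpair \<sigma> p" "\<And>w. w \<in> W \<Longrightarrow> T w \<bullet> w \<le> \<sigma> * (A w \<bullet> w)"
proof -
  define S where "S = W \<inter> sphere 0 1"
  have cA: "continuous_on S A" and cT: "continuous_on S T"
    using linear_A linear_T by (auto simp: linear_continuous_on linear_conv_bounded_linear)
  have "compact S"
    unfolding S_def by (simp add: closed_Int_compact closed_subspace subspace_W)
  moreover have "(1 / norm w0) *\<^sub>R w0 \<in> S"
    using assms by (simp add: S_def subspace_scale subspace_W)
  ultimately obtain p where p: "p \<in> S"
    and max: "\<And>w. w \<in> S \<Longrightarrow> T w \<bullet> w / (A w \<bullet> w) \<le> T p \<bullet> p / (A p \<bullet> p)"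
  proof -
    have "A w \<bullet> w \<noteq> 0" if "w \<in> S" for w
      using pos_A[of w] that by (force simp: S_def)
    then have "continuous_on S (\<lambda>w. T w \<bullet> w / (A w \<bullet> w))"
      using cA cT by (intro continuous_intros) auto
    then show ?thesis
      using continuous_attains_sup[OF \<open>compact S\<close>, of "\<lambda>w. T w \<bullet> w / (A w \<bullet> w)"] \<open>_ \<in> S\<close> that
      by blast
  qed
  define \<sigma> where "\<sigma> = T p \<bullet> p / (A p \<bullet> p)"
  have pW: "p \<in> W" "p \<noteq> 0"
    using p by (auto simp: S_def)
  have le: "T w \<bullet> w \<le> \<sigma> * (A w \<bullet> w)" if w: "w \<in> W" for w
  proof (cases "w = 0")
    case True
    then show ?thesis by simp
  next
    case False
    define u where "u = (1 / norm w) *\<^sub>R w"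
    have "u \<in> S"
      using False w by (simp add: u_def S_def subspace_scale subspace_W)
    then have "T u \<bullet> u / (A u \<bullet> u) \<le> \<sigma>"
      unfolding \<sigma>_def by (rule max)
    also have "T u \<bullet> u / (A u \<bullet> u) = T w \<bullet> w / (A w \<bullet> w)"
      using False by (simp add: u_def linear_scale[OF linear_A] linear_scale[OF linear_T])
    finally show ?thesis
      using pos_A[OF False] by (simp add: divide_simps)
  qed
  define F where "F x = \<sigma> *\<^sub>R A x - T x" for x
  have linF: "linear F"
    unfolding F_def using linear_A linear_T by (intro linear_compose_sub linear_compose_scale_right)
  have F0: "F p \<bullet> w = 0" if "w \<in> W" for w
  proof (rule psd_form_zero[OF linF _ subspace_W _ pW(1) _ that])
    show "F x \<bullet> y = x \<bullet> F y" for x y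
      by (simp add: F_def inner_diff_left inner_diff_right sym_A sym_T)
    show "0 \<le> F x \<bullet> x" if "x \<in> W" for x
      using le[OF that] by (simp add: F_def inner_diff_left)
    show "F p \<bullet> p = 0"
      using pos_A[OF pW(2)] by (simp add: F_def inner_diff_left \<sigma>_def)
  qed
  \<comment> \<open>\<open>F p\<close> is \<open>A\<close> applied to this vector, so testing
    against the vector itself yields its squared \<open>A\<close>-norm.\<close>
  have "\<sigma> *\<^sub>R p - K p \<in> W"
    using pW K_in_W by (simp add: subspace_diff subspace_scale subspace_W)
  from F0[OF this] have "A (\<sigma> *\<^sub>R p - K p) \<bullet> (\<sigma> *\<^sub>R p - K p) = 0"
    by (simp add: F_def linear_diff[OF linear_A] linear_scale[OF linear_A] A_K)
  then have "\<sigma> *\<^sub>R p = K p"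
    using pos_A[of "\<sigma> *\<^sub>R p - K p"] by auto
  then have "T p = \<sigma> *\<^sub>R A p"
    by (metis A_K linear_scale[OF linear_A])
  then show thesis
    using that pW le by (auto simp: eigpair_def)
qed

text \<open>With \<open>v = A p + T p\<close>, this is \<open>(D - 1) (A\<^sup>-\<^sup>1 v \<bullet> v) - D ((A + T)\<^sup>-\<^sup>1 v \<bullet> v)\<close>, the shape of the Hessian
  of \<open>\<Psi>\<^sub>1\<close>.\<close>

definition hess_form :: "real \<Rightarrow> 'a \<Rightarrow> real" where
  "hess_form D p = (D - 1) * ((p + K p) \<bullet> (A p + T p)) - D * (p \<bullet> (A p + T p))"

lemma hess_form_eq:
  "hess_form D p = (D - 1) * (K p \<bullet> T p) + (D - 2) * (T p \<bullet> p) - A p \<bullet> p"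
proof -
  have "K p \<bullet> A p = T p \<bullet> p"
    by (metis A_K sym_A)
  then show ?thesis
    by (simp add: hess_form_def inner_add_left inner_add_right inner_commute algebra_simps)
qed

lemma K_eigpair:
  assumes "eigpair k p"
  shows "K p = k *\<^sub>R p"
proof -
  have "A (K p - k *\<^sub>R p) = 0"
    using assms by (simp add: eigpair_def linear_diff[OF linear_A] linear_scale[OF linear_A] A_K)
  then show ?thesis
    using pos_A[of "K p - k *\<^sub>R p"] by auto
qed

lemma eigpair_flip:
  assumes "eigpair k p"
  shows "eigpair (- k) (J p)"
proof -
  have "J p \<bullet> J p \<noteq> 0"
    using assms by (simp add: inner_J eigpair_def)
  then show ?thesis
    using assms by (auto simp: eigpair_def J_in_W T_J A_J linear_scale[OF linear_J])
qed

text \<open>Stands in for a spectral decomposition: a bound on the form of \<open>T\<close> bounds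
  \<open>K\<close> in the \<open>A\<close>-norm, because \<open>K p \<bullet> T p\<close> is the
  squared \<open>A\<close>-norm of \<open>K p\<close>. The proof is polarisation, with the lower
  bound on \<open>T\<close> supplied by \<open>J\<close>.\<close>

lemma K_bound:
  assumes s: "s > 0" and le: "\<And>w. w \<in> W \<Longrightarrow> T w \<bullet> w \<le> s * (A w \<bullet> w)" and p: "p \<in> W"
  shows "K p \<bullet> T p \<le> s\<^sup>2 * (A p \<bullet> p)" "T p \<bullet> p \<le> s * (A p \<bullet> p)"
proof -
  have ge: "- (T w \<bullet> w) \<le> s * (A w \<bullet> w)" if "w \<in> W" for w
    using le[OF J_in_W[OF that]] by (simp add: T_J A_J inner_J)
  \<comment> \<open>With \<open>q = K p \<bullet> T p\<close>, the cross terms give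
    \<open>4 q / s\<close> on the left and \<open>r\<close> costs \<open>2 q / s\<close> on the
    right, leaving \<open>2 q / s \<le> 2 s (A p \<bullet> p)\<close>.\<close>
  define r where "r = (1 / s) *\<^sub>R K p"
  have r: "r \<in> W" "p + r \<in> W" "p - r \<in> W"
    using p K_in_W by (simp_all add: r_def subspace_scale subspace_add subspace_diff subspace_W)
  have "T (p + r) \<bullet> (p + r) - T (p - r) \<bullet> (p - r)
      \<le> s * (A (p + r) \<bullet> (p + r)) + s * (A (p - r) \<bullet> (p - r))"
    using le[OF r(2)] ge[OF r(3)] by linarith
  then have "2 * (T p \<bullet> r) + 2 * (T r \<bullet> p) \<le> 2 * s * (A p \<bullet> p) + 2 * s * (A r \<bullet> r)"
    by (simp add: linear_add[OF linear_A] linear_diff[OF linear_A] linear_add[OF linear_T]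
        linear_diff[OF linear_T] inner_add_left inner_add_right inner_diff_left inner_diff_right
        algebra_simps)
  moreover have "T p \<bullet> r = (K p \<bullet> T p) / s"
    by (simp add: r_def inner_commute)
  moreover have "T r \<bullet> p = (K p \<bullet> T p) / s"
    by (simp add: r_def linear_scale[OF linear_T] sym_T)
  moreover have "A r \<bullet> r = (K p \<bullet> T p) / s\<^sup>2"
    by (simp add: r_def linear_scale[OF linear_A] A_K inner_commute power2_eq_square)
  ultimately have "(K p \<bullet> T p) / s \<le> s * (A p \<bullet> p)"
    using s by (simp add: power2_eq_square)
  then show "K p \<bullet> T p \<le> s\<^sup>2 * (A p \<bullet> p)"
    using s by (simp add: field_simps power2_eq_square)
  show "T p \<bullet> p \<le> s * (A p \<bullet> p)"
    by (rule le[OF p])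
qed

text \<open>On an eigenvector the form is \<open>((D - 1) k - 1) (k + 1)\<close> times
  \<open>A p \<bullet> p\<close>. For general \<open>p\<close>, \<open>K_bound\<close> bounds it by
  the same polynomial at some \<open>s\<close> not below the top eigenvalue, as \<open>D - 1\<close>
  and \<open>D - 2\<close> are nonnegative. Negative eigenvalues are covered by
  \<open>eigpair_flip\<close>.\<close>

lemma eigenvalues_iff_hess_form_neg:
  assumes D: "D \<ge> 2"
  shows "(\<forall>k p. eigpair k p \<longrightarrow> \<bar>k\<bar> * (D - 1) < 1) \<longleftrightarrow> (\<forall>p\<in>W. p \<noteq> 0 \<longrightarrow> hess_form D p < 0)"
proof
  assume eig: "\<forall>k p. eigpair k p \<longrightarrow> \<bar>k\<bar> * (D - 1) < 1"
  show "\<forall>p\<in>W. p \<noteq> 0 \<longrightarrow> hess_form D p < 0"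
  proof (intro ballI impI)
    fix p assume p: "p \<in> W" "p \<noteq> 0"
    obtain \<sigma> p0 where \<sigma>: "eigpair \<sigma> p0" and le: "\<And>w. w \<in> W \<Longrightarrow> T w \<bullet> w \<le> \<sigma> * (A w \<bullet> w)"
      using rayleigh[OF p] by blast
    \<comment> \<open>\<open>K_bound\<close> needs a positive bound, while \<open>\<sigma>\<close>
      may be 0; \<open>1 / (2 (D - 1))\<close> is positive and still below
      \<open>1 / (D - 1)\<close>.\<close>
    define s where "s = max \<sigma> (1 / (2 * (D - 1)))"
    have "\<sigma> * (D - 1) \<le> \<bar>\<sigma>\<bar> * (D - 1)"
      using D by (intro mult_right_mono) auto
    then have "\<sigma> * (D - 1) < 1"
      using eig \<sigma> by fastforce
    moreover have "1 / (2 * (D - 1)) > 0" "1 / (2 * (D - 1)) * (D - 1) < 1"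
      using D by simp_all
    moreover have "s = \<sigma> \<or> s = 1 / (2 * (D - 1))" "s \<ge> 1 / (2 * (D - 1))"
      by (auto simp: s_def max_def)
    ultimately have s: "s > 0" "s * (D - 1) < 1"
      by (linarith, metis)
    have "A w \<bullet> w \<ge> 0" for w
      using pos_A[of w] by (cases "w = 0") auto
    then have "\<sigma> * (A w \<bullet> w) \<le> s * (A w \<bullet> w)" for w
      by (intro mult_right_mono) (auto simp: s_def)
    then have "T w \<bullet> w \<le> s * (A w \<bullet> w)" if "w \<in> W" for w
      using le[OF that] order_trans by blast
    note bd = K_bound[OF s(1) this p(1)]
    have "hess_form D p \<le> (D - 1) * (s\<^sup>2 * (A p \<bullet> p)) + (D - 2) * (s * (A p \<bullet> p)) - A p \<bullet> p"
      unfolding hess_form_eq using bd D by (intro diff_right_mono add_mono mult_left_mono) auto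
    also have "\<dots> = (s * (D - 1) - 1) * (s + 1) * (A p \<bullet> p)"
      by (simp add: algebra_simps power2_eq_square)
    also have "\<dots> < 0"
      using s pos_A[OF p(2)] by (simp add: mult_less_0_iff)
    finally show "hess_form D p < 0" .
  qed
next
  assume neg: "\<forall>p\<in>W. p \<noteq> 0 \<longrightarrow> hess_form D p < 0"
  have half: "k * (D - 1) < 1" if "eigpair k p" for k p
  proof -
    have p: "p \<in> W" "p \<noteq> 0" "T p = k *\<^sub>R A p"
      using that by (auto simp: eigpair_def)
    have "0 > hess_form D p"
      using neg p by blast
    also have "hess_form D p = ((k * (D - 1) - 1) * (k + 1)) * (A p \<bullet> p)"
      unfolding hess_form_eq K_eigpair[OF that] p(3)
      by (simp add: algebra_simps inner_commute)
    finally have neg: "(k * (D - 1) - 1) * (k + 1) < 0"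
      using pos_A[OF p(2)] by (simp add: mult_less_0_iff)
    show ?thesis
    proof (rule ccontr)
      assume ge: "\<not> ?thesis"
      then have "0 < k * (D - 1)"
        by linarith
      then have "k > 0"
        using D by (simp add: zero_less_mult_iff)
      then show False
        using neg ge by (simp add: mult_less_0_iff)
    qed
  qed
  show "\<forall>k p. eigpair k p \<longrightarrow> \<bar>k\<bar> * (D - 1) < 1"
    using half half[OF eigpair_flip] by (auto simp: abs_if)
qed

text \<open>\<open>\<pi>\<close> conjugates \<open>L\<close> on \<open>S\<close> to
  \<open>m K\<close> on \<open>W\<close>, and \<open>K\<close> is self-adjoint for the inner product
  given by \<open>A\<close>, so eigenvalues are real. The real or the imaginary part of a complex
  eigenvector is then a real one.\<close>

lemma cplx_eigenvalue_iff_eigpair: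
  assumes m: "m > 0" and S: "subspace S" and lin: "linear \<pi>"
    and bij: "bij_betw \<pi> S W" and L_in: "\<And>v. v \<in> S \<Longrightarrow> L v \<in> S"
    and conj: "\<And>v. v \<in> S \<Longrightarrow> \<pi> (L v) = m *\<^sub>R K (\<pi> v)"
  shows "cplx_eigenvalue_on L S z \<longleftrightarrow> Im z = 0 \<and> (\<exists>p. eigpair (Re z / m) p)"
proof
  assume "cplx_eigenvalue_on L S z"
  then obtain u v where uv: "u \<in> S" "v \<in> S" "u \<noteq> 0 \<or> v \<noteq> 0"
    and Lu: "L u = Re z *\<^sub>R u - Im z *\<^sub>R v" and Lv: "L v = Im z *\<^sub>R u + Re z *\<^sub>R v"
    by (auto simp: cplx_eigenvalue_on_def)
  define a b where "a = \<pi> u" and "b = \<pi> v"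
  have inj: "x = 0" if "x \<in> S" "\<pi> x = 0" for x
    using that bij subspace_0[OF S] linear_0[OF lin] by (metis bij_betw_imp_inj_on inj_on_eq_iff)
  have ab: "a \<in> W" "b \<in> W" "a \<noteq> 0 \<or> b \<noteq> 0"
    using uv bij inj by (auto simp: a_def b_def bij_betw_apply)
  have "m *\<^sub>R K a = Re z *\<^sub>R a - Im z *\<^sub>R b"
    using conj[OF uv(1)] by (simp add: a_def b_def Lu linear_diff[OF lin] linear_scale[OF lin])
  then have Ta: "m *\<^sub>R T a = Re z *\<^sub>R A a - Im z *\<^sub>R A b"
    by (metis A_K linear_diff[OF linear_A] linear_scale[OF linear_A])
  have "m *\<^sub>R K b = Im z *\<^sub>R a + Re z *\<^sub>R b"
    using conj[OF uv(2)] by (simp add: a_def b_def Lv linear_add[OF lin] linear_scale[OF lin])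
  then have Tb: "m *\<^sub>R T b = Im z *\<^sub>R A a + Re z *\<^sub>R A b"
    by (metis A_K linear_add[OF linear_A] linear_scale[OF linear_A])
  \<comment> \<open>Substituting the eigenvalue equations leaves \<open>Im z\<close> times the sum
    of the squared \<open>A\<close>-norms of \<open>a\<close> and \<open>b\<close>.\<close>
  have "(m *\<^sub>R T a) \<bullet> b = (m *\<^sub>R T b) \<bullet> a"
    using sym_T[of a b] by (simp add: inner_commute)
  then have "Im z * (A a \<bullet> a + A b \<bullet> b) = 0"
    using sym_A[of a b] unfolding Ta Tb
    by (simp add: inner_add_left inner_diff_left inner_commute algebra_simps)
  moreover have "A a \<bullet> a + A b \<bullet> b > 0"
    using ab(3) pos_A[of a] pos_A[of b] by (cases "a = 0"; cases "b = 0") auto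
  ultimately have Im: "Im z = 0"
    by simp
  have "T x = (Re z / m) *\<^sub>R A x" if "m *\<^sub>R T x = Re z *\<^sub>R A x" for x
    using arg_cong[OF that, of "\<lambda>y. (1 / m) *\<^sub>R y"] m by simp
  then have "eigpair (Re z / m) a \<or> eigpair (Re z / m) b"
    using Ta Tb Im ab by (auto simp: eigpair_def)
  then show "Im z = 0 \<and> (\<exists>p. eigpair (Re z / m) p)"
    using Im by blast
next
  assume "Im z = 0 \<and> (\<exists>p. eigpair (Re z / m) p)"
  then obtain p where Im: "Im z = 0" and p: "eigpair (Re z / m) p"
    by blast
  then have "p \<in> W" "p \<noteq> 0"
    by (auto simp: eigpair_def)
  then obtain u where u: "u \<in> S" "p = \<pi> u"
    using bij by (auto simp: bij_betw_def)
  have "\<pi> (L u) = \<pi> (Re z *\<^sub>R u)"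
    using conj[OF u(1)] K_eigpair[OF p] m u(2) by (simp add: linear_scale[OF lin])
  moreover have "L u \<in> S" "Re z *\<^sub>R u \<in> S"
    using u S L_in by (simp_all add: subspace_scale)
  ultimately have "L u = Re z *\<^sub>R u"
    using bij by (metis bij_betw_imp_inj_on inj_on_eq_iff)
  \<comment> \<open>The eigenvector given below has imaginary part 0. \<open>L\<close> is not
    assumed linear, so its value at 0 comes from the conjugacy.\<close>
  moreover have "L 0 = 0"
  proof -
    have "\<pi> (L 0) = m *\<^sub>R K 0"
      using conj[OF subspace_0[OF S]] by (simp add: linear_0[OF lin])
    also have "K 0 = 0"
      using A_K[of 0] pos_A[of "K 0"] linear_0[OF linear_T] by force
    finally show ?thesis
      using bij L_in[OF subspace_0[OF S]] subspace_0[OF S] linear_0[OF lin]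
      by (metis bij_betw_imp_inj_on inj_on_eq_iff scaleR_zero_right)
  qed
  moreover have "u \<noteq> 0"
    using u \<open>p \<noteq> 0\<close> linear_0[OF lin] by auto
  ultimately show "cplx_eigenvalue_on L S z"
    unfolding cplx_eigenvalue_on_def using Im u(1) subspace_0[OF S]
    by (intro bexI[of _ u] bexI[of _ 0]) auto
qed

text \<open>The top Rayleigh eigenvalue dominates the absolute value of every eigenvalue by symmetry
  of the spectrum. The supremum is therefore a maximum, and strict inequality passes between it and
  the single eigenvalues.\<close>

lemma spectral_radius_less_1_iff:
  assumes m: "m > 0"
    and iff: "\<And>z. cplx_eigenvalue_on L S z \<longleftrightarrow> Im z = 0 \<and> (\<exists>p. eigpair (Re z / m) p)"
  shows "spectral_radius_on L S < 1 \<longleftrightarrow> (\<forall>k p. eigpair k p \<longrightarrow> \<bar>k\<bar> * m < 1)"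
proof -
  let ?M = "insert 0 {cmod z | z. cplx_eigenvalue_on L S z}"
  have M: "?M = insert 0 {\<bar>k\<bar> * m | k. \<exists>p. eigpair k p}"
  proof -
    have "{cmod z | z. cplx_eigenvalue_on L S z} = {\<bar>k\<bar> * m | k. \<exists>p. eigpair k p}"
    proof (intro set_eqI iffI)
      fix y assume "y \<in> {cmod z | z. cplx_eigenvalue_on L S z}"
      then obtain z p where z: "y = cmod z" "Im z = 0" "eigpair (Re z / m) p"
        using iff by blast
      then have "y = \<bar>Re z / m\<bar> * m"
        using m by (simp add: cmod_eq_Re abs_divide)
      then show "y \<in> {\<bar>k\<bar> * m | k. \<exists>p. eigpair k p}"
        using z by blast
    next
      fix y assume "y \<in> {\<bar>k\<bar> * m | k. \<exists>p. eigpair k p}"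
      then obtain k p where k: "y = \<bar>k\<bar> * m" "eigpair k p"
        by blast
      then have "cplx_eigenvalue_on L S (of_real (k * m))" "y = cmod (of_real (k * m))"
        using m iff by (auto simp: abs_mult simp flip: of_real_mult)
      then show "y \<in> {cmod z | z. cplx_eigenvalue_on L S z}"
        by blast
    qed
    then show ?thesis by simp
  qed
  show ?thesis
  proof (cases "\<exists>k p. eigpair k p")
    \<comment> \<open>Only the inserted 0 remains in the set, and the condition on eigenpairs is
      vacuous.\<close>
    case False
    then have "?M = {0}"
      unfolding M by blast
    then show ?thesis
      using False unfolding spectral_radius_on_def by (simp only: cSup_singleton) simp
  next
    case True
    then obtain w where "w \<in> W" "w \<noteq> 0"
      by (auto simp: eigpair_def)
    then obtain \<sigma> p where \<sigma>: "eigpair \<sigma> p" and le: "\<And>w. w \<in> W \<Longrightarrow> T w \<bullet> w \<le> \<sigma> * (A w \<bullet> w)"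
      using rayleigh by blast
    have half: "k \<le> \<sigma>" if "eigpair k p" for k p
    proof -
      have "k * (A p \<bullet> p) \<le> \<sigma> * (A p \<bullet> p)" "A p \<bullet> p > 0"
        using le[of p] that pos_A[of p] by (auto simp: eigpair_def)
      then show ?thesis
        by simp
    qed
    have bound: "\<bar>k\<bar> \<le> \<sigma>" if "eigpair k p" for k p
      using half[OF that] half[OF eigpair_flip[OF that]] by linarith
    have "\<sigma> \<ge> 0"
      using bound[OF \<sigma>] by simp
    then have "\<exists>k. \<sigma> * m = \<bar>k\<bar> * m \<and> (\<exists>p. eigpair k p)"
      using \<sigma> by (intro exI[of _ \<sigma>]) auto
    then have "Sup ?M = \<sigma> * m"
      unfolding M using m bound \<open>\<sigma> \<ge> 0\<close> by (intro cSup_eq_maximum) (auto simp: mult_right_mono)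
    then have "spectral_radius_on L S = \<sigma> * m"
      by (simp add: spectral_radius_on_def)
    moreover have "\<bar>k\<bar> * m \<le> \<sigma> * m" if "eigpair k p" for k p
      using bound[OF that] m by (simp add: mult_right_mono)
    ultimately show ?thesis
      using \<sigma> \<open>\<sigma> \<ge> 0\<close> by (metis abs_of_nonneg order.strict_trans1)
  qed
qed

end

section \<open>Legendre duality for sums of exponentials\<close>

text \<open>The extra direction \<open>e\<close> makes the exponential potential strictly convex: below, the weights only see
  \<open>\<rho>\<^sub>i + \<gamma>\<^sub>j\<close>, so shifting \<open>\<rho>\<close> and \<open>\<gamma>\<close> by opposite constants has to be penalised.\<close>

locale exp_family =
  fixes I :: "'k set" and b :: "'k \<Rightarrow> real" and \<epsilon> :: "'k \<Rightarrow> 'a::euclidean_space" and e :: 'a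
  assumes finite_I: "finite I" and b_nonneg: "k \<in> I \<Longrightarrow> b k \<ge> 0"
    and separating: "(\<And>k. k \<in> I \<Longrightarrow> b k \<noteq> 0 \<Longrightarrow> \<epsilon> k \<bullet> v = 0) \<Longrightarrow> e \<bullet> v = 0 \<Longrightarrow> v = 0"
begin

definition pot :: "'a \<Rightarrow> real" where
  "pot p = (\<Sum>k\<in>I. b k * exp (\<epsilon> k \<bullet> p)) + (e \<bullet> p)\<^sup>2 / 2"

definition grad :: "'a \<Rightarrow> 'a" where
  "grad p = (\<Sum>k\<in>I. (b k * exp (\<epsilon> k \<bullet> p)) *\<^sub>R \<epsilon> k) + (e \<bullet> p) *\<^sub>R e"

definition hess :: "'a \<Rightarrow> 'a \<Rightarrow> 'a" where
  "hess p v = (\<Sum>k\<in>I. (b k * exp (\<epsilon> k \<bullet> p) * (\<epsilon> k \<bullet> v)) *\<^sub>R \<epsilon> k) + (e \<bullet> v) *\<^sub>R e"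

lemma has_derivative_pot: "(pot has_derivative (\<lambda>v. grad p \<bullet> v)) (at p)"
  unfolding pot_def grad_def
  by (auto intro!: derivative_eq_intros sum.cong
      simp: inner_add_left inner_sum_left algebra_simps fun_eq_iff)

lemma has_derivative_grad: "(grad has_derivative hess p) (at p)"
  unfolding hess_def[abs_def] grad_def
  by (auto intro!: derivative_eq_intros sum.cong simp: algebra_simps fun_eq_iff)

lemma linear_hess: "linear (hess p)"
  using has_derivative_grad has_derivative_linear by blast

text \<open>Makes the monotonicity of \<open>grad\<close> visible: the exponential is increasing, so
  both differences in a summand have the same sign.\<close>

lemma inner_grad_diff:
  "(grad p - grad q) \<bullet> (p - q) =
    (\<Sum>k\<in>I. b k * ((exp (\<epsilon> k \<bullet> p) - exp (\<epsilon> k \<bullet> q)) * (\<epsilon> k \<bullet> p - \<epsilon> k \<bullet> q))) + (e \<bullet> (p - q))\<^sup>2"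
proof -
  have g: "grad x \<bullet> d = (\<Sum>k\<in>I. b k * exp (\<epsilon> k \<bullet> x) * (\<epsilon> k \<bullet> d)) + (e \<bullet> x) * (e \<bullet> d)" for x d
    by (simp add: grad_def inner_add_left inner_sum_left)
  have "(grad p - grad q) \<bullet> (p - q) =
      (\<Sum>k\<in>I. b k * exp (\<epsilon> k \<bullet> p) * (\<epsilon> k \<bullet> (p - q)) - b k * exp (\<epsilon> k \<bullet> q) * (\<epsilon> k \<bullet> (p - q)))
      + (e \<bullet> (p - q))\<^sup>2"
    by (simp only: inner_diff_left g sum_subtractf)
      (simp add: inner_diff_right power2_eq_square algebra_simps)
  also have "(\<Sum>k\<in>I. b k * exp (\<epsilon> k \<bullet> p) * (\<epsilon> k \<bullet> (p - q)) - b k * exp (\<epsilon> k \<bullet> q) * (\<epsilon> k \<bullet> (p - q)))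
      = (\<Sum>k\<in>I. b k * ((exp (\<epsilon> k \<bullet> p) - exp (\<epsilon> k \<bullet> q)) * (\<epsilon> k \<bullet> p - \<epsilon> k \<bullet> q)))"
    by (rule sum.cong) (simp_all add: inner_diff_right algebra_simps)
  finally show ?thesis .
qed

lemma inj_grad: "inj grad"
proof (rule injI)
  fix p q assume eq: "grad p = grad q"
  let ?s = "\<lambda>k. b k * ((exp (\<epsilon> k \<bullet> p) - exp (\<epsilon> k \<bullet> q)) * (\<epsilon> k \<bullet> p - \<epsilon> k \<bullet> q))"
  have mono: "0 \<le> (exp x - exp y) * (x - y)" for x y :: real
    by (cases "x \<le> y") (auto simp: mult_nonneg_nonneg mult_nonpos_nonpos)
  have nonneg: "0 \<le> ?s k" if "k \<in> I" for k
    using b_nonneg[OF that] mono by simp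
  have zero: "sum ?s I + (e \<bullet> (p - q))\<^sup>2 = 0"
    using inner_grad_diff[of p q] eq by simp
  have "0 \<le> sum ?s I"
    using nonneg by (rule sum_nonneg)
  then have s0: "sum ?s I = 0" and e0: "e \<bullet> (p - q) = 0"
    using zero by (simp_all add: add_nonneg_eq_0_iff)
  have "p - q = 0"
  proof (rule separating[OF _ e0])
    fix k assume k: "k \<in> I" "b k \<noteq> 0"
    have "?s k = 0"
      by (rule sum_nonneg_0[OF finite_I _ s0 k(1)]) (rule nonneg)
    then show "\<epsilon> k \<bullet> (p - q) = 0"
      using k by (simp add: inner_diff_right)
  qed
  then show "p = q" by simp
qed

text \<open>The quadratic form of \<open>hess p\<close> is a weighted sum of squares plus
  \<open>(e \<bullet> v)^2\<close>, and \<open>separating\<close> excludes nonzero zeros of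
  it.\<close>

lemma bij_hess: "bij (hess p)"
proof -
  have "v = 0" if "hess p v = 0" for v
  proof -
    let ?s = "\<lambda>k. b k * exp (\<epsilon> k \<bullet> p) * (\<epsilon> k \<bullet> v)\<^sup>2"
    have nonneg: "0 \<le> ?s k" if "k \<in> I" for k
      using b_nonneg[OF that] by simp
    have "hess p v \<bullet> v = sum ?s I + (e \<bullet> v)\<^sup>2"
      by (simp add: hess_def inner_add_left inner_sum_left power2_eq_square algebra_simps)
    then have zero: "sum ?s I + (e \<bullet> v)\<^sup>2 = 0"
      using that by simp
    have "0 \<le> sum ?s I"
      using nonneg by (rule sum_nonneg)
    then have s0: "sum ?s I = 0" and e0: "e \<bullet> v = 0"
      using zero by (simp_all add: add_nonneg_eq_0_iff)
    show ?thesis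
    proof (rule separating[OF _ e0])
      fix k assume k: "k \<in> I" "b k \<noteq> 0"
      have "?s k = 0"
        by (rule sum_nonneg_0[OF finite_I _ s0 k(1)]) (rule nonneg)
      then show "\<epsilon> k \<bullet> v = 0"
        using k by simp
    qed
  qed
  then have "inj (hess p)"
    using linear_injective_0[OF linear_hess] by blast
  then show ?thesis
    using linear_hess linear_injective_imp_surjective by (auto simp: bij_def)
qed

section \<open>Inverse gradient and Legendre transform\<close>

definition grad_inv :: "'a \<Rightarrow> 'a" where
  "grad_inv = inv grad"

definition hess_inv :: "'a \<Rightarrow> 'a \<Rightarrow> 'a" where
  "hess_inv p = inv (hess p)"

lemma grad_inv_grad [simp]: "grad_inv (grad p) = p"
  by (simp add: grad_inv_def inj_grad)

lemma hess_hess_inv [simp]: "hess p (hess_inv p v) = v"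
  using bij_hess by (simp add: hess_inv_def bij_def surj_f_inv_f)

lemma hess_inv_hess [simp]: "hess_inv p (hess p v) = v"
  using bij_hess by (simp add: hess_inv_def bij_def)

lemma continuous_on_grad: "continuous_on UNIV grad"
  using has_derivative_continuous[OF has_derivative_grad] by (simp add: continuous_at_imp_continuous_on)

text \<open>Invariance of domain. It provides a full neighbourhood of the critical point on which
  dual variables exist.\<close>

lemma open_range_grad: "open (range grad)"
  using continuous_on_grad inj_grad by (intro invariance_of_domain) auto

lemma has_derivative_grad_inv: "(grad_inv has_derivative hess_inv p) (at (grad p))"
  by (rule has_derivative_inverse_strong[OF open_UNIV UNIV_I continuous_on_grad _ has_derivative_grad])
    (auto simp: fun_eq_iff)

text \<open>The Legendre transform of \<open>pot\<close>, taken at the stationary point instead of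
  as a supremum; meaningful on the range of \<open>grad\<close>.\<close>

definition conj_pot :: "'a \<Rightarrow> real" where
  "conj_pot y = y \<bullet> grad_inv y - pot (grad_inv y)"

text \<open>Envelope argument: the two terms with the derivative of \<open>grad_inv\<close> cancel,
  since \<open>grad\<close> at \<open>grad_inv y\<close> is \<open>y\<close>.\<close>

lemma has_derivative_conj_pot:
  assumes "y \<in> range grad"
  shows "(conj_pot has_derivative (\<lambda>v. grad_inv y \<bullet> v)) (at y)"
proof -
  obtain p where p: "y = grad p"
    using assms by blast
  have inv: "(grad_inv has_derivative hess_inv p) (at y)"
    using has_derivative_grad_inv p by simp
  have "(pot has_derivative (\<lambda>v. grad p \<bullet> v)) (at (grad_inv y))"
    using has_derivative_pot p by simp
  with inv have "((\<lambda>y. pot (grad_inv y)) has_derivative (\<lambda>v. grad p \<bullet> hess_inv p v)) (at y)"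
    by (rule has_derivative_compose)
  with has_derivative_inner[OF has_derivative_ident inv]
  have "(conj_pot has_derivative (\<lambda>v. (y \<bullet> hess_inv p v + v \<bullet> grad_inv y) - grad p \<bullet> hess_inv p v)) (at y)"
    unfolding conj_pot_def[abs_def] by (rule has_derivative_diff)
  moreover have "(y \<bullet> hess_inv p v + v \<bullet> grad_inv y) - grad p \<bullet> hess_inv p v = grad_inv y \<bullet> v" for v
    unfolding p by (simp add: inner_commute)
  ultimately show ?thesis
    by simp
qed

end

section \<open>Gibbs variational principle and uniqueness of the Hessian\<close>

lemma psi1_feasible_sum_swap:
  fixes \<rho> \<gamma> :: "real^'q"
  assumes "y \<in> psi1_feasible \<alpha> \<beta>"
  shows "(\<Sum>i\<in>UNIV. \<Sum>j\<in>UNIV. y$i$j * (\<rho>$i + \<gamma>$j)) = \<alpha> \<bullet> \<rho> + \<beta> \<bullet> \<gamma>"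
proof -
  have "(\<Sum>i\<in>UNIV. \<Sum>j\<in>UNIV. y$i$j * (\<rho>$i + \<gamma>$j))
      = (\<Sum>i\<in>UNIV. \<Sum>j\<in>UNIV. y$i$j * \<rho>$i) + (\<Sum>j\<in>UNIV. \<Sum>i\<in>UNIV. y$i$j * \<gamma>$j)"
    by (subst sum.swap[where g = "\<lambda>j i. y$i$j * \<gamma>$j"]) (simp add: distrib_left sum.distrib)
  also have "\<dots> = (\<Sum>i\<in>UNIV. (\<Sum>j\<in>UNIV. y$i$j) * \<rho>$i) + (\<Sum>j\<in>UNIV. (\<Sum>i\<in>UNIV. y$i$j) * \<gamma>$j)"
    by (simp add: sum_distrib_right)
  also have "\<dots> = \<alpha> \<bullet> \<rho> + \<beta> \<bullet> \<gamma>"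
    using assms by (simp add: psi1_feasible_def inner_vec_def)
  finally show ?thesis .
qed

text \<open>This is \<open>ln t \<le> t - 1\<close> at \<open>t = b exp u / y\<close>; equality
  holds at the Gibbs weight \<open>y = b exp u\<close>.\<close>

lemma relative_entropy_term:
  fixes b y u :: real
  assumes "b \<ge> 0" "y \<ge> 0" "b = 0 \<Longrightarrow> y = 0"
  shows "(if y = 0 then 0 else y * (ln b - ln y)) \<le> b * exp u - y - y * u"
proof (cases "y = 0")
  case True
  then show ?thesis using assms by simp
next
  case False
  then have pos: "b > 0" "y > 0"
    using assms by (auto simp: order_less_le)
  have "ln (b * exp u / y) \<le> b * exp u / y - 1"
    using pos by (intro ln_le_minus_one) simp
  then have "ln b + u - ln y \<le> b * exp u / y - 1"
    using pos by (simp add: ln_div ln_mult)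
  then have "y * (ln b + u - ln y) \<le> y * (b * exp u / y - 1)"
    using pos by (intro mult_left_mono) auto
  also have "\<dots> = b * exp u - y"
    using pos by (simp add: field_simps)
  finally show ?thesis
    using False by (simp add: algebra_simps)
qed

text \<open>A Gibbs matrix with the right marginals solves the inner maximisation: the termwise
  entropy bounds are tight at \<open>x\<close>, and their sum depends on the competitor only through
  its marginals.\<close>

lemma Psi1_gibbs:
  fixes B x :: "real^'q^'q"
  assumes B: "\<And>i j. B$i$j \<ge> 0" and D: "D \<ge> 0"
    and x: "\<And>i j. x$i$j = B$i$j * exp (\<rho>$i + \<gamma>$j)"
    and row: "\<And>i. (\<Sum>j\<in>UNIV. x$i$j) = \<alpha>$i" and col: "\<And>j. (\<Sum>i\<in>UNIV. x$i$j) = \<beta>$j"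
  shows "Psi1 B D \<alpha> \<beta> = ereal ((D - 1) * ((\<Sum>i\<in>UNIV. xlnx (\<alpha>$i)) + (\<Sum>j\<in>UNIV. xlnx (\<beta>$j)))
           - D * (\<alpha> \<bullet> \<rho> + \<beta> \<bullet> \<gamma>))" (is "_ = ereal ?v")
proof -
  have xf: "x \<in> psi1_feasible \<alpha> \<beta>"
    using row col B by (simp add: psi1_feasible_def x)
  have term_x: "(if x$i$j = 0 then 0 else x$i$j * (ln (B$i$j) - ln (x$i$j))) = - (x$i$j * (\<rho>$i + \<gamma>$j))"
    for i j
    using B[of i j] by (auto simp: x ln_mult order_less_le algebra_simps)
  have "(\<Sum>i\<in>UNIV. \<Sum>j\<in>UNIV. if x$i$j = 0 then 0 else x$i$j * (ln (B$i$j) - ln (x$i$j)))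
      = - (\<alpha> \<bullet> \<rho> + \<beta> \<bullet> \<gamma>)"
    unfolding term_x by (simp add: sum_negf psi1_feasible_sum_swap[OF xf])
  moreover have "(\<exists>i j. B$i$j = 0 \<and> x$i$j \<noteq> 0) = False"
    by (simp add: x)
  ultimately have obj_x: "psi1_obj B D \<alpha> \<beta> x = ereal ?v"
    by (simp only: psi1_obj_def if_False mult_minus_right) simp
  have "psi1_obj B D \<alpha> \<beta> y \<le> ereal ?v" if y: "y \<in> psi1_feasible \<alpha> \<beta>" for y
  proof (cases "\<exists>i j. B$i$j = 0 \<and> y$i$j \<noteq> 0")
    case True
    then show ?thesis by (simp add: psi1_obj_def)
  next
    case False
    \<comment> \<open>Equal total masses cancel the terms \<open>x - y\<close> in the summed
      bounds.\<close>
    have tot: "(\<Sum>i\<in>UNIV. \<Sum>j\<in>UNIV. y$i$j) = (\<Sum>i\<in>UNIV. \<alpha>$i)" "(\<Sum>i\<in>UNIV. \<Sum>j\<in>UNIV. x$i$j) = (\<Sum>i\<in>UNIV. \<alpha>$i)"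
      using y row by (simp_all add: psi1_feasible_def)
    have "(\<Sum>i\<in>UNIV. \<Sum>j\<in>UNIV. if y$i$j = 0 then 0 else y$i$j * (ln (B$i$j) - ln (y$i$j)))
        \<le> (\<Sum>i\<in>UNIV. \<Sum>j\<in>UNIV. x$i$j - y$i$j - y$i$j * (\<rho>$i + \<gamma>$j))"
    proof (intro sum_mono)
      fix i j
      show "(if y$i$j = 0 then 0 else y$i$j * (ln (B$i$j) - ln (y$i$j)))
          \<le> x$i$j - y$i$j - y$i$j * (\<rho>$i + \<gamma>$j)"
        unfolding x using y False by (intro relative_entropy_term B) (auto simp: psi1_feasible_def)
    qed
    also have "\<dots> = - (\<alpha> \<bullet> \<rho> + \<beta> \<bullet> \<gamma>)"
      using tot by (simp add: sum_subtractf psi1_feasible_sum_swap[OF y])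
    finally have "D * (\<Sum>i\<in>UNIV. \<Sum>j\<in>UNIV. if y$i$j = 0 then 0 else y$i$j * (ln (B$i$j) - ln (y$i$j)))
        \<le> D * - (\<alpha> \<bullet> \<rho> + \<beta> \<bullet> \<gamma>)"
      using D by (rule mult_left_mono)
    moreover have "(\<exists>i j. B$i$j = 0 \<and> y$i$j \<noteq> 0) = False"
      using False by blast
    ultimately show ?thesis
      by (simp only: psi1_obj_def if_False ereal_less_eq mult_minus_right)
  qed
  then have "Psi1 B D \<alpha> \<beta> \<le> ereal ?v"
    unfolding Psi1_def by (rule SUP_least)
  moreover have "ereal ?v \<le> Psi1 B D \<alpha> \<beta>"
    unfolding Psi1_def obj_x[symmetric] by (rule SUP_upper[OF xf])
  ultimately show ?thesis
    by (rule antisym)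
qed

text \<open>A finite value needs a feasible matrix supported where \<open>B\<close> is nonzero, and
  there the additive potential vanishes.\<close>

lemma Psi1_finite_orthogonal:
  fixes B :: "real^'q^'q"
  assumes fin: "Psi1 B D \<alpha> \<beta> = ereal c"
    and zero: "\<And>i j. B$i$j \<noteq> 0 \<Longrightarrow> \<rho>$i + \<gamma>$j = 0"
  shows "\<alpha> \<bullet> \<rho> + \<beta> \<bullet> \<gamma> = 0"
proof -
  have "\<exists>y\<in>psi1_feasible \<alpha> \<beta>. psi1_obj B D \<alpha> \<beta> y \<noteq> -\<infinity>"
  proof (rule ccontr)
    assume "\<not> ?thesis"
    then have "Psi1 B D \<alpha> \<beta> \<le> -\<infinity>"
      unfolding Psi1_def by (intro SUP_least) auto
    then show False
      using fin by simp
  qed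
  then obtain y where y: "y \<in> psi1_feasible \<alpha> \<beta>" and "psi1_obj B D \<alpha> \<beta> y \<noteq> -\<infinity>"
    by blast
  then have "\<forall>i j. B$i$j = 0 \<longrightarrow> y$i$j = 0"
    unfolding psi1_obj_def by (metis (full_types))
  then have "(\<Sum>i\<in>UNIV. \<Sum>j\<in>UNIV. y$i$j * (\<rho>$i + \<gamma>$j)) = 0"
    using zero by (intro sum.neutral ballI) (metis mult_eq_0_iff)
  then show ?thesis
    using psi1_feasible_sum_swap[OF y, of \<rho> \<gamma>] by simp
qed

section \<open>Derivatives within the constraint plane\<close>

lemma constr_dirs_iff: "v \<in> constr_dirs \<longleftrightarrow> (\<Sum>i\<in>UNIV. fst v $ i) = 0 \<and> (\<Sum>j\<in>UNIV. snd v $ j) = 0"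
  by (cases v) (simp add: constr_dirs_def)

lemma subspace_constr_dirs: "subspace constr_dirs"
  by (auto simp: subspace_def constr_dirs_def sum.distrib zero_prod_def simp flip: sum_distrib_left)

text \<open>A derivative within a subspace is determined only along it; restriction to the line
  \<open>x + t v\<close> reduces this to uniqueness in one variable.\<close>

lemma has_derivative_within_zero:
  fixes f :: "'a::real_normed_vector \<Rightarrow> 'b::real_normed_vector"
  assumes der: "(f has_derivative f') (at x within S)" and S: "subspace S"
    and xv: "x \<in> S" "v \<in> S" and d: "d > 0" and zero: "\<And>y. y \<in> S \<Longrightarrow> norm (y - x) < d \<Longrightarrow> f y = 0"
  shows "f' v = 0"
proof -
  have 0: "((\<lambda>_. 0) has_derivative f') (at x within S)"
    using der d xv(1) zero by (rule has_derivative_transform_within) (simp_all add: dist_norm)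
  have "range (\<lambda>t. x + t *\<^sub>R v) \<subseteq> S"
    using xv S by (auto intro: subspace_add subspace_scale)
  then have "((\<lambda>_. 0) has_derivative f') (at (x + 0 *\<^sub>R v) within range (\<lambda>t. x + t *\<^sub>R v))"
    using has_derivative_subset[OF 0] by simp
  moreover have "((\<lambda>t. x + t *\<^sub>R v) has_derivative (\<lambda>t. t *\<^sub>R v)) (at 0)"
    by (auto intro!: derivative_eq_intros)
  ultimately have "((\<lambda>_::real. 0 :: 'b) has_derivative (\<lambda>t. f' (t *\<^sub>R v))) (at 0)"
    by (intro has_derivative_in_compose[where f = "\<lambda>t. x + t *\<^sub>R v" and g = "\<lambda>_. 0"])
  then have "(\<lambda>t. f' (t *\<^sub>R v)) = (\<lambda>_. 0)"
    by (rule has_derivative_unique) simp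
  from fun_cong[OF this, of 1] show ?thesis
    by simp
qed

text \<open>The definition asks for some \<open>g\<close>, \<open>G\<close>, \<open>H\<close>; this
  lets one explicit choice decide it. Two gradient fields may differ normal to the plane, but their
  pairings with plane directions agree, hence so do the quadratic forms.\<close>

lemma hessian_local_max_iff:
  fixes B :: "real^'q^'q" and g :: "(real^'q) \<times> (real^'q) \<Rightarrow> real"
  assumes \<epsilon>: "\<epsilon> > 0"
    and val: "\<And>h. h \<in> constr_dirs \<Longrightarrow> norm h < \<epsilon> \<Longrightarrow> Psi1 B D (\<alpha> + fst h) (\<beta> + snd h) = ereal (g h)"
    and der: "\<And>h. h \<in> constr_dirs \<Longrightarrow> norm h < \<epsilon> \<Longrightarrow> (g has_derivative (\<lambda>v. G h \<bullet> v)) (at h within constr_dirs)"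
    and der2: "(G has_derivative H) (at 0 within constr_dirs)"
    and crit: "\<And>v. v \<in> constr_dirs \<Longrightarrow> G 0 \<bullet> v = 0"
  shows "hessian_local_max B D \<alpha> \<beta> \<longleftrightarrow> (\<forall>v\<in>constr_dirs. v \<noteq> 0 \<longrightarrow> H v \<bullet> v < 0)"
proof
  assume "\<forall>v\<in>constr_dirs. v \<noteq> 0 \<longrightarrow> H v \<bullet> v < 0"
  then show "hessian_local_max B D \<alpha> \<beta>"
    unfolding hessian_local_max_def using assms by blast
next
  assume "hessian_local_max B D \<alpha> \<beta>"
  then obtain \<epsilon>' and g' :: "(real^'q) \<times> (real^'q) \<Rightarrow> real" and G' H' where \<epsilon>': "\<epsilon>' > 0"
    and val': "\<forall>h\<in>constr_dirs. norm h < \<epsilon>' \<longrightarrow> Psi1 B D (\<alpha> + fst h) (\<beta> + snd h) = ereal (g' h)"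
    and der': "\<forall>h\<in>constr_dirs. norm h < \<epsilon>' \<longrightarrow> (g' has_derivative (\<lambda>v. G' h \<bullet> v)) (at h within constr_dirs)"
    and der2': "(G' has_derivative H') (at 0 within constr_dirs)"
    and neg': "\<forall>v\<in>constr_dirs. v \<noteq> 0 \<longrightarrow> H' v \<bullet> v < 0"
    unfolding hessian_local_max_def by blast
  define d where "d = min \<epsilon> \<epsilon>'"
  have d: "d > 0" "\<And>h. norm h < d \<Longrightarrow> norm h < \<epsilon> \<and> norm h < \<epsilon>'"
    using \<epsilon> \<epsilon>' by (auto simp: d_def)
  have G: "G h \<bullet> v - G' h \<bullet> v = 0" if h: "h \<in> constr_dirs" "norm h < d" and v: "v \<in> constr_dirs" for h v
  proof (rule has_derivative_within_zero[where f = "\<lambda>h. g h - g' h" and f' = "\<lambda>v. G h \<bullet> v - G' h \<bullet> v",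
        OF _ subspace_constr_dirs h(1) v])
    show "((\<lambda>h. g h - g' h) has_derivative (\<lambda>v. G h \<bullet> v - G' h \<bullet> v)) (at h within constr_dirs)"
      using der[OF h(1)] der' h(1) d(2)[OF h(2)] by (intro has_derivative_diff) blast+
    show "d - norm h > 0"
      using h by simp
    fix y assume y: "y \<in> constr_dirs" "norm (y - h) < d - norm h"
    then have "norm y < d"
      using norm_triangle_sub[of y h] by linarith
    then have "ereal (g y) = ereal (g' y)"
      using val[OF y(1)] val' y(1) d(2) by metis
    then show "g y - g' y = 0"
      by simp
  qed
  have "H v \<bullet> v - H' v \<bullet> v = 0" if v: "v \<in> constr_dirs" for v
  proof (rule has_derivative_within_zero[where f = "\<lambda>h. G h \<bullet> v - G' h \<bullet> v"
        and f' = "\<lambda>w. H w \<bullet> v - H' w \<bullet> v",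
        OF _ subspace_constr_dirs subspace_0[OF subspace_constr_dirs] v d(1)])
    show "((\<lambda>h. G h \<bullet> v - G' h \<bullet> v) has_derivative (\<lambda>w. H w \<bullet> v - H' w \<bullet> v)) (at 0 within constr_dirs)"
      using der2 der2' by (intro has_derivative_diff has_derivative_inner_left)
  qed (use G v in auto)
  then show "\<forall>v\<in>constr_dirs. v \<noteq> 0 \<longrightarrow> H v \<bullet> v < 0"
    using neg' by (metis eq_iff_diff_eq_0)
qed

section \<open>Couplings\<close>

text \<open>With \<open>X\<close> read as a joint law, a pair consists of a function of the row and
  a function of the column. \<open>diag\<close>, \<open>cross\<close>, \<open>cond\<close> and
  \<open>flip\<close> below play \<open>A\<close>, \<open>T\<close>, \<open>K\<close> and
  \<open>J\<close> of the pencil.\<close>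

locale coupling =
  fixes X :: "real^'q^'q" and \<alpha> \<beta> :: "real^'q"
  assumes row_sum: "(\<Sum>j\<in>UNIV. X$i$j) = \<alpha>$i" and col_sum: "(\<Sum>i\<in>UNIV. X$i$j) = \<beta>$j"
    and \<alpha>_pos: "\<alpha>$i > 0" and \<beta>_pos: "\<beta>$j > 0" and sum_\<alpha>: "(\<Sum>i\<in>UNIV. \<alpha>$i) = 1"
begin

lemma sum_\<beta>: "(\<Sum>j\<in>UNIV. \<beta>$j) = 1"
  using sum_\<alpha> sum.swap[of "\<lambda>i j. X$i$j" UNIV UNIV] by (simp add: row_sum col_sum)

definition diag :: "(real^'q) \<times> (real^'q) \<Rightarrow> (real^'q) \<times> (real^'q)" where
  "diag p = (\<chi> i. \<alpha>$i * fst p $ i, \<chi> j. \<beta>$j * snd p $ j)"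

definition cross :: "(real^'q) \<times> (real^'q) \<Rightarrow> (real^'q) \<times> (real^'q)" where
  "cross p = (X *v snd p, transpose X *v fst p)"

text \<open>Conditional expectation: each half becomes the average of the other half given its own
  coordinate.\<close>

definition cond :: "(real^'q) \<times> (real^'q) \<Rightarrow> (real^'q) \<times> (real^'q)" where
  "cond p = (\<chi> i. (X *v snd p) $ i / \<alpha>$i, \<chi> j. (transpose X *v fst p) $ j / \<beta>$j)"

text \<open>\<open>cross\<close> exchanges the two halves, so negating one of them reverses its
  sign.\<close>

definition flip :: "(real^'q) \<times> (real^'q) \<Rightarrow> (real^'q) \<times> (real^'q)" where
  "flip p = (fst p, - snd p)"

definition centered :: "((real^'q) \<times> (real^'q)) set" where
  "centered = {p. \<alpha> \<bullet> fst p = 0 \<and> \<beta> \<bullet> snd p = 0}"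

lemma \<alpha>_cond: "(\<Sum>i\<in>UNIV. (X *v b) $ i) = \<beta> \<bullet> b"
  by (simp add: matrix_vector_mult_def inner_vec_def sum.swap[of "\<lambda>i j. X$i$j * b$j"]
      flip: sum_distrib_right col_sum)

lemma \<beta>_cond: "(\<Sum>j\<in>UNIV. (transpose X *v a) $ j) = \<alpha> \<bullet> a"
  by (simp add: matrix_vector_mult_def transpose_def inner_vec_def sum.swap[of "\<lambda>j i. X$i$j * a$i"]
      flip: sum_distrib_right row_sum)

lemma cond_centered: "p \<in> centered \<Longrightarrow> cond p \<in> centered"
  using \<alpha>_pos \<beta>_pos \<alpha>_cond[of "snd p"] \<beta>_cond[of "fst p"]
  by (simp add: centered_def cond_def inner_vec_def less_imp_neq[symmetric])

sublocale sym_pencil diag cross cond flip centered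
proof (rule sym_pencil.intro)
  show "linear diag"
    by (rule linearI) (auto simp: diag_def vec_eq_iff algebra_simps)
  show "linear cross"
    by (rule linearI) (auto simp: cross_def matrix_vector_right_distrib matrix_vector_mult_scaleR)
  show "linear flip"
    by (rule linearI) (auto simp: flip_def)
  show "diag x \<bullet> y = x \<bullet> diag y" for x y
    by (simp add: diag_def inner_prod_def inner_vec_def algebra_simps)
  show "cross x \<bullet> y = x \<bullet> cross y" for x y
    using dot_lmul_matrix[of "fst x" X "snd y"] dot_lmul_matrix[of "fst y" X "snd x"]
    by (simp add: cross_def inner_prod_def transpose_matrix_vector inner_commute)
  show "diag x \<bullet> x > 0" if "x \<noteq> 0" for x
  proof -
    have sq: "0 \<le> \<alpha>$i * fst x $ i * fst x $ i" "0 \<le> \<beta>$i * snd x $ i * snd x $ i" for i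
      using less_imp_le[OF \<alpha>_pos] less_imp_le[OF \<beta>_pos] by (simp_all add: mult.assoc)
    have "\<exists>i. fst x $ i \<noteq> 0 \<or> snd x $ i \<noteq> 0"
    proof (rule ccontr)
      assume "\<not> ?thesis"
      then have "fst x = 0" "snd x = 0"
        by (auto simp: vec_eq_iff)
      then show False
        using that by (simp add: prod_eq_iff)
    qed
    then obtain i where i: "fst x $ i \<noteq> 0 \<or> snd x $ i \<noteq> 0"
      by blast
    have "0 < \<alpha>$i * fst x $ i * fst x $ i + \<beta>$i * snd x $ i * snd x $ i"
    proof (cases "fst x $ i = 0")
      case True
      then show ?thesis
        using i \<beta>_pos[of i] by (auto simp: mult.assoc zero_less_mult_iff linorder_neq_iff)
    next
      case False
      then have "0 < \<alpha>$i * fst x $ i * fst x $ i"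
        using \<alpha>_pos[of i] by (auto simp: mult.assoc zero_less_mult_iff linorder_neq_iff)
      then show ?thesis
        using sq(2)[of i] by linarith
    qed
    then have "0 < (\<Sum>i\<in>UNIV. \<alpha>$i * fst x $ i * fst x $ i + \<beta>$i * snd x $ i * snd x $ i)"
      using sq by (intro sum_pos2[of _ i] add_nonneg_nonneg) auto
    then show ?thesis
      by (simp add: diag_def inner_prod_def inner_vec_def sum.distrib)
  qed
  show "subspace centered"
    by (auto simp: subspace_def centered_def inner_add_right)
  show "diag (cond x) = cross x" for x
    using \<alpha>_pos \<beta>_pos by (simp add: diag_def cond_def cross_def vec_eq_iff less_imp_neq[symmetric])
  show "x \<in> centered \<Longrightarrow> cond x \<in> centered" for x
    by (rule cond_centered)
  show "x \<in> centered \<Longrightarrow> flip x \<in> centered" for x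
    by (simp add: centered_def flip_def)
  show "diag (flip x) = flip (diag x)" for x
    by (simp add: diag_def flip_def vec_eq_iff)
  show "cross (flip x) = - flip (cross x)" for x
    by (simp add: cross_def flip_def vec_eq_iff matrix_vector_mult_def sum_negf)
  show "flip x \<bullet> flip y = x \<bullet> y" for x y
    by (simp add: flip_def inner_prod_def)
qed

text \<open>The constant pairs form an invariant plane with eigenvalues 1 and -1. In logarithmic
  coordinates they are the rescaling directions, which centering removes.\<close>

lemma cond_const: "cond (vec s, vec t) = (vec t, vec s)"
  using \<alpha>_pos \<beta>_pos
  by (simp add: cond_def vec_eq_iff matrix_vector_mult_def transpose_def less_imp_neq[symmetric]
      flip: sum_distrib_right) (simp add: row_sum col_sum less_imp_neq[symmetric] \<alpha>_pos \<beta>_pos)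

lemma const_centered_iff: "(vec s, vec t) \<in> centered \<longleftrightarrow> s = 0 \<and> t = 0"
  by (simp add: centered_def inner_vec_def sum_\<alpha> sum_\<beta> flip: sum_distrib_right)

text \<open>The projection along the constant pairs, orthogonal for the inner product given by
  \<open>diag\<close>.\<close>

definition center :: "(real^'q) \<times> (real^'q) \<Rightarrow> (real^'q) \<times> (real^'q)" where
  "center p = p - (vec (\<alpha> \<bullet> fst p), vec (\<beta> \<bullet> snd p))"

lemma inner_vec_const: "\<alpha> \<bullet> vec s = s" "\<beta> \<bullet> vec s = s"
  by (simp_all add: inner_vec_def sum_\<alpha> sum_\<beta> flip: sum_distrib_right)

lemma linear_center: "linear center"
  by (rule linearI) (auto simp: center_def inner_add_right vec_eq_iff algebra_simps)

lemma center_const: "center (vec s, vec t) = 0"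
  by (simp add: center_def inner_vec_const zero_prod_def)

lemma center_in_centered: "center p \<in> centered"
  by (simp add: center_def centered_def inner_diff_right inner_vec_const)

lemma center_id: "p \<in> centered \<Longrightarrow> center p = p"
  by (simp add: center_def centered_def prod_eq_iff vec_eq_iff)

lemma linear_cond: "linear cond"
  by (rule linearI)
    (auto simp: cond_def vec_eq_iff matrix_vector_right_distrib matrix_vector_mult_scaleR add_divide_distrib)

lemma cond_center: "cond (center p) = center (cond p)"
proof -
  have "\<alpha> \<bullet> fst (cond p) = \<beta> \<bullet> snd p" "\<beta> \<bullet> snd (cond p) = \<alpha> \<bullet> fst p"
    using \<alpha>_pos \<beta>_pos \<alpha>_cond[of "snd p"] \<beta>_cond[of "fst p"]
    by (simp_all add: cond_def inner_vec_def less_imp_neq[symmetric])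
  then show ?thesis
    by (simp add: center_def linear_diff[OF linear_cond] cond_const)
qed

end

section \<open>The Jacobian of the tree recursion\<close>

lemma has_derivative_vecI:
  fixes f :: "'a::real_normed_vector \<Rightarrow> real^'n"
  assumes "\<And>i. ((\<lambda>x. f x $ i) has_derivative (\<lambda>v. f' v $ i)) (at a within S)"
  shows "(f has_derivative f') (at a within S)"
  using assms by (subst has_derivative_componentwise_within) (auto simp: Basis_vec_def inner_axis)

text \<open>The logarithmic derivative of the power is \<open>n\<close> times that of the linear
  form, and normalising subtracts its mean. The mean has weights \<open>r\<close> because the
  fixpoint equation makes the powers proportional to \<open>r\<close>.\<close>

lemma has_derivative_normalized_power:
  fixes M :: "real^'q^'q" and c r :: "real^'q"
  assumes pos: "\<And>i. (M *v c) $ i > 0" and fp: "\<And>i. (M *v c) $ i ^ n = k * r $ i"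
    and r: "(\<Sum>i\<in>UNIV. r $ i) = 1" and k: "k > 0" and n: "n \<ge> 1"
  shows "((\<lambda>x. normalize_vec (\<chi> i. (\<Sum>j\<in>UNIV. M $ i $ j * x $ j) ^ n)) has_derivative
    (\<lambda>b. \<chi> i. n * r $ i * ((M *v b) $ i / (M *v c) $ i
        - (\<Sum>i\<in>UNIV. r $ i * ((M *v b) $ i / (M *v c) $ i))))) (at c)"
proof (rule has_derivative_vecI)
  fix i
  define q where "q b i = (M *v b) $ i / (M *v c) $ i" for b i
  have pow: "((\<lambda>x. (M *v x) $ i ^ n) has_derivative (\<lambda>b. n * k * r $ i * q b i)) (at c)" for i
  proof -
    have "((\<lambda>x. (M *v x) $ i) has_derivative (\<lambda>b. (M *v b) $ i)) (at c)"
      by (intro bounded_linear_imp_has_derivative bounded_linear_compose[OF bounded_linear_vec_nth]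
          matrix_vector_mul_bounded_linear)
    from has_derivative_power[OF this, of n]
    have "((\<lambda>x. (M *v x) $ i ^ n) has_derivative (\<lambda>b. n * (M *v b) $ i * (M *v c) $ i ^ (n - 1))) (at c)" .
    moreover have "n * (M *v b) $ i * (M *v c) $ i ^ (n - 1) = n * k * r $ i * q b i" for b
    proof -
      have "(M *v c) $ i ^ (n - 1) = k * r $ i / (M *v c) $ i"
        using n pos[of i] by (simp add: power_diff flip: fp)
      then show ?thesis
        by (simp add: q_def)
    qed
    ultimately show ?thesis
      by (simp only:)
  qed
  have tot: "(\<Sum>i\<in>UNIV. (M *v c) $ i ^ n) = k"
    by (simp add: fp r flip: sum_distrib_left)
  have "((\<lambda>x. (M *v x) $ i ^ n / (\<Sum>i\<in>UNIV. (M *v x) $ i ^ n)) has_derivative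
      (\<lambda>b. (n * k * r $ i * q b i * (\<Sum>i\<in>UNIV. (M *v c) $ i ^ n)
        - (M *v c) $ i ^ n * (\<Sum>i\<in>UNIV. n * k * r $ i * q b i))
        / ((\<Sum>i\<in>UNIV. (M *v c) $ i ^ n) * (\<Sum>i\<in>UNIV. (M *v c) $ i ^ n)))) (at c)"
    using tot k by (intro has_derivative_divide' has_derivative_sum pow) auto
  moreover have "(n * k * r $ i * q b i * (\<Sum>i\<in>UNIV. (M *v c) $ i ^ n)
        - (M *v c) $ i ^ n * (\<Sum>i\<in>UNIV. n * k * r $ i * q b i))
        / ((\<Sum>i\<in>UNIV. (M *v c) $ i ^ n) * (\<Sum>i\<in>UNIV. (M *v c) $ i ^ n))
      = n * r $ i * (q b i - (\<Sum>i\<in>UNIV. r $ i * q b i))" for b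
  proof -
    have "(\<Sum>i\<in>UNIV. n * k * r $ i * q b i) = n * k * (\<Sum>i\<in>UNIV. r $ i * q b i)"
      by (simp add: sum_distrib_left mult.assoc)
    then show ?thesis
      unfolding tot unfolding fp using k by (simp add: field_simps)
  qed
  ultimately show "((\<lambda>x. normalize_vec (\<chi> i. (\<Sum>j\<in>UNIV. M $ i $ j * x $ j) ^ n) $ i) has_derivative
      (\<lambda>b. (\<chi> i. n * r $ i * ((M *v b) $ i / (M *v c) $ i
        - (\<Sum>i\<in>UNIV. r $ i * ((M *v b) $ i / (M *v c) $ i)))) $ i)) (at c)"
    by (simp add: normalize_vec_def matrix_vector_mult_def q_def)
qed

lemma sum_weighted_deviation:
  fixes m :: real
  assumes "(\<Sum>i\<in>I. a i) = 1"
  shows "(\<Sum>i\<in>I. m * a i * (f i - (\<Sum>i\<in>I. a i * f i))) = 0"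
proof -
  define F where "F = (\<Sum>i\<in>I. a i * f i)"
  have "(\<Sum>i\<in>I. m * a i * (f i - F)) = m * ((\<Sum>i\<in>I. a i * f i) - (\<Sum>i\<in>I. a i) * F)"
    by (simp add: sum_distrib_right sum_distrib_left sum_subtractf right_diff_distrib mult.assoc)
  then show ?thesis
    using assms by (simp add: F_def)
qed

section \<open>Normalised fixpoints of the tree recursion\<close>

locale tree_fixpoint =
  fixes B :: "real^'q^'q" and \<Delta> :: nat and r c :: "real^'q" and k1 k2 :: real
  assumes B_nonneg: "B $ i $ j \<ge> 0" and \<Delta>_ge: "\<Delta> \<ge> 3"
    and r_pos: "r $ i > 0" and c_pos: "c $ i > 0"
    and sum_r: "(\<Sum>i\<in>UNIV. r $ i) = 1" and sum_c: "(\<Sum>i\<in>UNIV. c $ i) = 1"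
    and k1_pos: "k1 > 0" and k2_pos: "k2 > 0"
    and fix_r: "(B *v c) $ i ^ (\<Delta> - 1) = k1 * r $ i"
    and fix_c: "(transpose B *v r) $ i ^ (\<Delta> - 1) = k2 * c $ i"
begin

lemma nz [simp]: "r $ i \<noteq> 0" "c $ i \<noteq> 0" 
  using r_pos[of i] c_pos[of i] by simp_all

lemma Bc_pos: "(B *v c) $ i > 0"
proof -
  have "(B *v c) $ i \<ge> 0"
    using B_nonneg c_pos by (simp add: matrix_vector_mult_def sum_nonneg less_imp_le)
  moreover have "(B *v c) $ i \<noteq> 0"
    using fix_r[of i] k1_pos \<Delta>_ge r_pos[of i] by (auto simp: power_0_left)
  ultimately show ?thesis by simp
qed

lemma Br_pos: "(transpose B *v r) $ i > 0"
proof -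
  have "(transpose B *v r) $ i \<ge> 0"
    using B_nonneg r_pos by (simp add: matrix_vector_mult_def transpose_def sum_nonneg less_imp_le)
  moreover have "(transpose B *v r) $ i \<noteq> 0"
    using fix_c[of i] k2_pos \<Delta>_ge c_pos[of i] by (auto simp: power_0_left)
  ultimately show ?thesis by simp
qed

definition Z :: real where
  "Z = (\<Sum>i\<in>UNIV. r $ i * (B *v c) $ i)"

lemma Z_pos: "Z > 0"
  unfolding Z_def by (intro sum_pos mult_pos_pos r_pos Bc_pos) auto

definition X :: "real^'q^'q" where
  "X = (\<chi> i j. r $ i * B $ i $ j * c $ j / Z)"

text \<open>The row marginal of \<open>X\<close>; \<open>corr_vec_eq\<close> later identifies it
  with the power formula of the correspondence.\<close>

definition \<alpha> :: "real^'q" where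
  "\<alpha> = (\<chi> i. r $ i * (B *v c) $ i / Z)"

definition \<beta> :: "real^'q" where
  "\<beta> = (\<chi> j. c $ j * (transpose B *v r) $ j / Z)"

sublocale coupling X \<alpha> \<beta>
proof
  show "(\<Sum>j\<in>UNIV. X $ i $ j) = \<alpha> $ i" for i
    by (simp add: X_def \<alpha>_def matrix_vector_mult_def sum_distrib_left sum_divide_distrib mult.assoc)
  show "(\<Sum>i\<in>UNIV. X $ i $ j) = \<beta> $ j" for j
    by (simp add: X_def \<beta>_def matrix_vector_mult_def transpose_def sum_distrib_left sum_divide_distrib mult_ac)
  show "\<alpha> $ i > 0" "\<beta> $ i > 0" for i
    using r_pos c_pos Bc_pos Br_pos Z_pos by (simp_all add: \<alpha>_def \<beta>_def)
  show "(\<Sum>i\<in>UNIV. \<alpha> $ i) = 1"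
    using Z_pos by (simp add: \<alpha>_def Z_def flip: sum_divide_distrib)
qed

text \<open>Dividing a tangent vector by the fixpoint and removing the means conjugates the Jacobian to a
  multiple of the self-adjoint operator \<open>cond\<close>.\<close>

definition scaled :: "(real^'q) \<times> (real^'q) \<Rightarrow> (real^'q) \<times> (real^'q)" where
  "scaled v = (\<chi> i. fst v $ i / r $ i, \<chi> j. snd v $ j / c $ j)"

definition jac :: "(real^'q) \<times> (real^'q) \<Rightarrow> (real^'q) \<times> (real^'q)" where
  "jac v = (\<chi> i. (\<Delta> - 1) * r $ i * ((B *v snd v) $ i / (B *v c) $ i
              - (\<Sum>i\<in>UNIV. r $ i * ((B *v snd v) $ i / (B *v c) $ i))),
            \<chi> j. (\<Delta> - 1) * c $ j * ((transpose B *v fst v) $ j / (transpose B *v r) $ j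
              - (\<Sum>j\<in>UNIV. c $ j * ((transpose B *v fst v) $ j / (transpose B *v r) $ j))))"

lemma has_derivative_proj_tree_rec: "(proj_tree_rec B \<Delta> has_derivative jac) (at (r, c))"
proof -
  have n: "\<Delta> - 1 \<ge> 1"
    using \<Delta>_ge by simp
  have "((\<lambda>x. normalize_vec (\<chi> i. (\<Sum>j\<in>UNIV. B $ i $ j * x $ j) ^ (\<Delta> - 1))) has_derivative
      (\<lambda>b. fst (jac (0, b)))) (at (snd (r, c)))"
    using has_derivative_normalized_power[OF Bc_pos fix_r sum_r k1_pos n] by (simp add: jac_def)
  from has_derivative_compose[OF has_derivative_snd[OF has_derivative_ident] this]
  have 1: "((\<lambda>p. normalize_vec (\<chi> i. (\<Sum>j\<in>UNIV. B $ i $ j * snd p $ j) ^ (\<Delta> - 1))) has_derivative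
      (\<lambda>v. fst (jac v))) (at (r, c))"
    by (simp add: jac_def)
  have "((\<lambda>x. normalize_vec (\<chi> i. (\<Sum>j\<in>UNIV. transpose B $ i $ j * x $ j) ^ (\<Delta> - 1))) has_derivative
      (\<lambda>a. snd (jac (a, 0)))) (at (fst (r, c)))"
    using has_derivative_normalized_power[OF Br_pos fix_c sum_c k2_pos n] by (simp add: jac_def)
  from has_derivative_compose[OF has_derivative_fst[OF has_derivative_ident] this]
  have 2: "((\<lambda>p. normalize_vec (\<chi> i. (\<Sum>j\<in>UNIV. transpose B $ i $ j * fst p $ j) ^ (\<Delta> - 1))) has_derivative
      (\<lambda>v. snd (jac v))) (at (r, c))"
    by (simp add: jac_def)
  have "proj_tree_rec B \<Delta> = (\<lambda>x. (normalize_vec (\<chi> i. (\<Sum>j\<in>UNIV. B $ i $ j * snd x $ j) ^ (\<Delta> - 1)),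
      normalize_vec (\<chi> i. (\<Sum>j\<in>UNIV. transpose B $ i $ j * fst x $ j) ^ (\<Delta> - 1))))"
    by (simp add: fun_eq_iff proj_tree_rec_def tree_rec_def transpose_def)
  then show ?thesis
    using has_derivative_Pair[OF 1 2] by simp
qed

text \<open>The fixpoint weights and \<open>Z\<close> cancel, so in logarithmic coordinates
  \<open>cond\<close> is the logarithmic derivative of the linear part of the recursion.\<close>

lemma cond_scaled:
  "cond (scaled v) = (\<chi> i. (B *v snd v) $ i / (B *v c) $ i, \<chi> j. (transpose B *v fst v) $ j / (transpose B *v r) $ j)"
proof -
  have "(X *v snd (scaled v)) $ i = r $ i * (B *v snd v) $ i / Z" for i
    by (simp add: X_def scaled_def matrix_vector_mult_def sum_distrib_left sum_divide_distrib mult.assoc)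
  moreover have "(transpose X *v fst (scaled v)) $ j = c $ j * (transpose B *v fst v) $ j / Z" for j
    by (simp add: X_def scaled_def matrix_vector_mult_def transpose_def sum_distrib_left sum_divide_distrib mult_ac)
  ultimately show ?thesis
    using Z_pos unfolding cond_def by (simp add: \<alpha>_def \<beta>_def vec_eq_iff)
qed

text \<open>The chart subtracts means weighted by \<open>r\<close> and \<open>c\<close>,
  \<open>center\<close> those weighted by \<open>\<alpha>\<close> and \<open>\<beta>\<close>. The
  difference is a constant pair, which \<open>center\<close> kills.\<close>

lemma center_scaled_jac: "center (scaled (jac v)) = real (\<Delta> - 1) *\<^sub>R cond (center (scaled v))"
proof -
  define s t where "s = (\<Sum>i\<in>UNIV. r $ i * fst (cond (scaled v)) $ i)"
    and "t = (\<Sum>j\<in>UNIV. c $ j * snd (cond (scaled v)) $ j)"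
  have "scaled (jac v) = real (\<Delta> - 1) *\<^sub>R (cond (scaled v) - (vec s, vec t))"
    unfolding s_def t_def cond_scaled jac_def by (simp add: scaled_def prod_eq_iff vec_eq_iff)
  then show ?thesis
    by (simp add: linear_scale[OF linear_center] linear_diff[OF linear_center] center_const cond_center)
qed

lemma jac_in_constr_dirs: "jac v \<in> constr_dirs"
proof -
  define f g where "f i = (B *v snd v) $ i / (B *v c) $ i"
    and "g j = (transpose B *v fst v) $ j / (transpose B *v r) $ j" for i j
  have "fst (jac v) $ i = real (\<Delta> - 1) * r $ i * (f i - (\<Sum>i\<in>UNIV. r $ i * f i))"
    and "snd (jac v) $ i = real (\<Delta> - 1) * c $ i * (g i - (\<Sum>i\<in>UNIV. c $ i * g i))" for i
    by (simp_all add: jac_def f_def g_def)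
  note eq = this
  show ?thesis
    unfolding constr_dirs_iff
    using trans[OF sum.cong[OF refl eq(1)] sum_weighted_deviation[OF sum_r]]
      trans[OF sum.cong[OF refl eq(2)] sum_weighted_deviation[OF sum_c]]
    by blast
qed

lemma linear_scaled: "linear scaled"
  by (rule linearI) (auto simp: scaled_def vec_eq_iff add_divide_distrib)

lemma bij_betw_center_scaled: "bij_betw (\<lambda>v. center (scaled v)) constr_dirs centered"
proof -
  \<comment> \<open>The inverse map: subtract means with weights \<open>r\<close> and
    \<open>c\<close>, then multiply back by the fixpoint. Constants added by \<open>center\<close>
    drop out.\<close>
  define g where "g p = (\<chi> i. r $ i * (fst p $ i - (\<Sum>i\<in>UNIV. r $ i * fst p $ i)),
      \<chi> j. c $ j * (snd p $ j - (\<Sum>j\<in>UNIV. c $ j * snd p $ j)))" for p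
  have sc: "scaled (g p) = p - (vec (\<Sum>i\<in>UNIV. r $ i * fst p $ i), vec (\<Sum>j\<in>UNIV. c $ j * snd p $ j))" for p
    by (simp add: scaled_def g_def prod_eq_iff vec_eq_iff)
  have g_const: "g (p - (vec s, vec t)) = g p" for p s t
    using sum_r sum_c
    by (simp add: g_def right_diff_distrib sum_subtractf flip: sum_distrib_right)
  show ?thesis
  proof (rule bij_betwI[where g = g])
    show "(\<lambda>v. center (scaled v)) \<in> constr_dirs \<rightarrow> centered"
      by (simp add: center_in_centered)
    show "g \<in> centered \<rightarrow> constr_dirs"
      by (intro Pi_I) (simp add: g_def constr_dirs_iff,
        intro conjI sum_weighted_deviation[where m = 1, simplified] sum_r sum_c)
    show "g (center (scaled v)) = v" if "v \<in> constr_dirs" for v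
    proof -
      have "g (center (scaled v)) = g (scaled v)"
        unfolding center_def by (rule g_const)
      also have "\<dots> = v"
        using that by (auto simp: g_def scaled_def constr_dirs_def vec_eq_iff)
      finally show ?thesis .
    qed
    show "center (scaled (g p)) = p" if "p \<in> centered" for p
      using that by (simp add: sc linear_diff[OF linear_center] center_const center_id)
  qed
qed

lemma jacobian_attractive_iff:
  "jacobian_attractive B \<Delta> r c \<longleftrightarrow> (\<forall>k p. eigpair k p \<longrightarrow> \<bar>k\<bar> * (real \<Delta> - 1) < 1)"
proof -
  have m: "real (\<Delta> - 1) > 0" "real (\<Delta> - 1) = real \<Delta> - 1"
    using \<Delta>_ge by simp_all
  have "normalize_vec r = r" "normalize_vec c = c"
    by (simp_all add: normalize_vec_def sum_r sum_c)
  then have "jacobian_attractive B \<Delta> r c \<longleftrightarrow> spectral_radius_on jac constr_dirs < 1"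
    unfolding jacobian_attractive_def
    using has_derivative_proj_tree_rec has_derivative_unique by (metis (no_types))
  also have "\<dots> \<longleftrightarrow> (\<forall>k p. eigpair k p \<longrightarrow> \<bar>k\<bar> * real (\<Delta> - 1) < 1)"
  proof (rule spectral_radius_less_1_iff[OF m(1)], rule cplx_eigenvalue_iff_eigpair[OF m(1)])
    show "subspace (constr_dirs :: ((real^'q) \<times> (real^'q)) set)"
      by (rule subspace_constr_dirs)
    show "linear (\<lambda>v. center (scaled v))"
      using linear_compose[OF linear_scaled linear_center] by (simp add: o_def)
  qed (use bij_betw_center_scaled jac_in_constr_dirs center_scaled_jac in auto)
  finally show ?thesis
    unfolding m(2) .
qed

end

section \<open>The Hessian\<close>

text \<open>The edge \<open>(i, j)\<close> as a vector, so that pairing with potentials gives the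
  sum of the potentials at its two ends.\<close>

definition incidence :: "'q \<times> 'q \<Rightarrow> (real^'q) \<times> (real^'q)" where
  "incidence k = (axis (fst k) 1, axis (snd k) 1)"

text \<open>Spans the shifts that leave all edge sums fixed; it serves as \<open>e\<close> in
  \<open>exp_family\<close>.\<close>

definition skew_dir :: "(real^'q) \<times> (real^'q)" where
  "skew_dir = (vec 1, - vec 1)"

lemma inner_incidence: "incidence k \<bullet> p = fst p $ fst k + snd p $ snd k"
  by (simp add: incidence_def inner_prod_def inner_axis')

lemma inner_skew_dir: "skew_dir \<bullet> p = (\<Sum>i\<in>UNIV. fst p $ i) - (\<Sum>j\<in>UNIV. snd p $ j)"
  by (simp add: skew_dir_def inner_prod_def inner_vec_def sum_negf)

lemma sum_incidence:
  fixes f :: "'q \<times> 'q::finite \<Rightarrow> real"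
  shows "(\<Sum>k\<in>UNIV. f k *\<^sub>R incidence k) = (\<chi> i. \<Sum>j\<in>UNIV. f (i, j), \<chi> j. \<Sum>i\<in>UNIV. f (i, j))"
proof -
  have "(\<Sum>k\<in>UNIV. f k * (axis (fst k) 1 $ i)) = (\<Sum>j\<in>UNIV. f (i, j))" for i
  proof -
    have "(\<Sum>k\<in>UNIV. f k * (axis (fst k) 1 $ i)) = (\<Sum>a\<in>UNIV. \<Sum>j\<in>UNIV. f (a, j) * (axis a 1 $ i))"
      by (simp add: sum.cartesian_product' flip: UNIV_Times_UNIV)
    also have "\<dots> = (\<Sum>a\<in>UNIV. if a = i then (\<Sum>j\<in>UNIV. f (a, j)) else 0)"
      by (rule sum.cong) (auto simp: axis_def)
    finally show ?thesis
      by simp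
  qed
  moreover have "(\<Sum>k\<in>UNIV. f k * (axis (snd k) 1 $ j)) = (\<Sum>i\<in>UNIV. f (i, j))" for j
  proof -
    have "(\<Sum>k\<in>UNIV. f k * (axis (snd k) 1 $ j)) = (\<Sum>a\<in>UNIV. \<Sum>b\<in>UNIV. f (a, b) * (axis b 1 $ j))"
      by (simp add: sum.cartesian_product' flip: UNIV_Times_UNIV)
    also have "\<dots> = (\<Sum>a\<in>UNIV. \<Sum>b\<in>UNIV. if b = j then f (a, b) else 0)"
      by (intro sum.cong) (auto simp: axis_def)
    finally show ?thesis
      by simp
  qed
  ultimately show ?thesis
    by (simp add: incidence_def prod_eq_iff vec_eq_iff fst_sum snd_sum)
qed

lemma inner_const_constr_dirs: "v \<in> constr_dirs \<Longrightarrow> (vec s, vec t) \<bullet> v = 0"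
  by (auto simp: constr_dirs_def inner_prod_def inner_vec_def simp flip: sum_distrib_left)

lemma DERIV_xlnx:
  assumes "x > 0"
  shows "(xlnx has_real_derivative ln x + 1) (at x)"
proof -
  have "xlnx = (\<lambda>t. t * ln t)"
    by (auto simp: xlnx_def fun_eq_iff)
  moreover have "((\<lambda>t. t * ln t) has_real_derivative ln x + 1) (at x)"
    using assms by (auto intro!: derivative_eq_intros)
  ultimately show ?thesis
    by simp
qed

text \<open>\<open>A + T\<close> is the signless Laplacian of the bipartite graph with edge weights
  \<open>X\<close>. This links it to the Hessian of the exponential potential and writes its form as
  a weighted sum of squares over edges.\<close>

lemma (in coupling) diag_cross_eq:
  "diag p + cross p = (\<Sum>k\<in>UNIV. (X $ fst k $ snd k * (incidence k \<bullet> p)) *\<^sub>R incidence k)"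
  unfolding sum_incidence
  by (simp add: inner_incidence diag_def cross_def prod_eq_iff vec_eq_iff matrix_vector_mult_def
      transpose_def distrib_left sum.distrib row_sum col_sum flip: sum_distrib_right)

section \<open>The eigenvalue -1 and the Hessian at the critical point\<close>

context tree_fixpoint
begin

text \<open>Such a vector lies in the kernel of \<open>diag + cross\<close>, so every square in the
  edge sum with nonzero weight vanishes.\<close>

lemma eigpair_minus_one_vanishes:
  assumes "eigpair (-1) p" "B $ i $ j \<noteq> 0"
  shows "fst p $ i + snd p $ j = 0"
proof -
  let ?s = "\<lambda>k. X $ fst k $ snd k * (incidence k \<bullet> p)\<^sup>2"
  have Xnn: "X $ a $ b \<ge> 0" for a b
    using B_nonneg r_pos c_pos Z_pos by (simp add: X_def less_imp_le)
  have "(diag p + cross p) \<bullet> p = 0"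
    using assms(1) by (simp add: eigpair_def)
  then have "(\<Sum>k\<in>UNIV. ?s k) = 0"
    by (simp add: diag_cross_eq inner_sum_left power2_eq_square mult.assoc)
  then have "?s (i, j) = 0"
    by (intro sum_nonneg_0[of UNIV ?s]) (auto simp: Xnn)
  moreover have "X $ i $ j \<noteq> 0"
    using assms(2) Z_pos by (simp add: X_def)
  ultimately show ?thesis
    by (simp add: inner_incidence)
qed

text \<open>If the bipartite graph of \<open>B\<close> is disconnected, \<open>\<Psi>\<^sub>1\<close> is \<open>-\<infinity>\<close> arbitrarily close to the critical point.\<close>

lemma not_hessian_local_max_if_eigpair_minus_one:
  assumes p: "eigpair (-1) p"
  shows "\<not> hessian_local_max B D \<alpha> \<beta>"
proof
  assume "hessian_local_max B D \<alpha> \<beta>"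
  then obtain \<epsilon> and g :: "(real^'q) \<times> (real^'q) \<Rightarrow> real" where \<epsilon>: "\<epsilon> > 0"
    and val: "\<And>h. h \<in> constr_dirs \<Longrightarrow> norm h < \<epsilon> \<Longrightarrow> Psi1 B D (\<alpha> + fst h) (\<beta> + snd h) = ereal (g h)"
    unfolding hessian_local_max_def by blast
  define s t where "s = (\<Sum>i\<in>UNIV. fst p $ i) / real CARD('q)" and "t = (\<Sum>i\<in>UNIV. snd p $ i) / real CARD('q)"
  \<comment> \<open>The orthogonal projection of \<open>p\<close> to the constraint directions, so
    \<open>a \<bullet> p\<close> is its squared norm. Finiteness of \<open>Psi1\<close> along
    \<open>a\<close> forces this to be 0; then \<open>p\<close> is a constant pair, hence 0 as it is
    centered.\<close>
  define a where "a = p - (vec s, vec t)"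
  have a: "a \<in> constr_dirs"
    by (simp add: a_def constr_dirs_iff s_def t_def sum_subtractf)
  define \<tau> where "\<tau> = \<epsilon> / (norm a + 1)"
  have "norm a + 1 > 0"
    by (simp add: add_nonneg_pos)
  then have \<tau>: "\<tau> > 0" "norm (\<tau> *\<^sub>R a) < \<epsilon>"
    using \<epsilon> by (simp_all add: \<tau>_def field_simps)
  have "\<tau> *\<^sub>R a \<in> constr_dirs"
    by (rule subspace_scale[OF subspace_constr_dirs a])
  from Psi1_finite_orthogonal[OF val[OF this \<tau>(2)] eigpair_minus_one_vanishes[OF p]]
  have "(\<alpha> + fst (\<tau> *\<^sub>R a)) \<bullet> fst p + (\<beta> + snd (\<tau> *\<^sub>R a)) \<bullet> snd p = 0"
    by simp
  moreover have "\<alpha> \<bullet> fst p = 0" "\<beta> \<bullet> snd p = 0"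
    using p unfolding eigpair_def by (auto simp: centered_def)
  ultimately have "\<tau> * (a \<bullet> p) = 0"
    by (simp add: inner_add_left inner_prod_def distrib_left)
  then have "a \<bullet> p = 0"
    using \<tau>(1) by simp
  moreover have "a \<bullet> p = a \<bullet> a + (vec s, vec t) \<bullet> a"
    by (simp add: a_def inner_diff_right inner_diff_left inner_commute)
  ultimately have "p = (vec s, vec t)"
    using inner_const_constr_dirs[OF a] by (simp add: a_def)
  then show False
    using p const_centered_iff[of s t] by (auto simp: eigpair_def zero_prod_def)
qed

text \<open>Vanishing on edges gives \<open>cond v = - v\<close>. The centered part of
  \<open>v\<close> would be an eigenvector for -1, so it is 0 and \<open>v\<close> is a constant
  pair \<open>(s, - s)\<close>; orthogonality to \<open>skew_dir\<close> leaves
  \<open>s = 0\<close>.\<close>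

lemma separating_if_no_eigpair_minus_one:
  assumes no: "\<And>p. \<not> eigpair (-1) p"
    and van: "\<And>i j. B $ i $ j \<noteq> 0 \<Longrightarrow> incidence (i, j) \<bullet> v = 0" and g0: "skew_dir \<bullet> v = 0"
  shows "v = 0"
proof -
  have Xv: "X $ i $ j * (incidence (i, j) \<bullet> v) = 0" for i j
    using van[of i j] by (cases "B $ i $ j = 0") (auto simp: X_def)
  then have zero: "diag v + cross v = 0"
    unfolding diag_cross_eq sum_incidence
    by (simp only: fst_conv snd_conv Xv sum.neutral_const) (simp add: vec_eq_iff zero_prod_def)
  define s where "s = \<alpha> \<bullet> fst v"
  have "(vec 1, vec 1) \<bullet> (diag v + cross v) = 2 * (\<alpha> \<bullet> fst v + \<beta> \<bullet> snd v)"
    using \<alpha>_cond[of "snd v"] \<beta>_cond[of "fst v"]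
    by (simp add: diag_def cross_def inner_prod_def inner_add_right inner_vec_def sum.distrib)
  then have t: "\<beta> \<bullet> snd v = - s"
    using zero by (simp add: s_def)
  have "center v \<in> centered"
    by (rule center_in_centered)
  moreover have "cross (center v) = -1 *\<^sub>R diag (center v)"
  proof -
    have "cond v = - v"
    proof -
      have "diag (cond v + v) = 0"
        using zero by (simp add: linear_add[OF linear_A] A_K add.commute)
      then show ?thesis
        using pos_A[of "cond v + v"] by (auto simp: eq_neg_iff_add_eq_0)
    qed
    then have "cond (center v) = - center v"
      by (simp add: cond_center linear_neg[OF linear_center])
    then show ?thesis
      by (metis A_K linear_neg[OF linear_A] scaleR_minus1_left)
  qed
  ultimately have "center v = 0"
    using no[of "center v"] by (auto simp: eigpair_def)
  then have v: "v = (vec s, vec (- s))"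
    by (simp add: center_def s_def t[unfolded s_def])
  then have "2 * real CARD('q) * s = 0"
    using g0 by (simp add: inner_skew_dir)
  then show ?thesis
    using v by (simp add: zero_prod_def vec_eq_iff)
qed

text \<open>Near the critical point \<open>Psi1\<close> is explicit through \<open>conj_pot\<close>,
  whose Hessian inverts \<open>A + T\<close> up to the penalty. The substitution
  \<open>v = A p + T p\<close> reaches all constraint directions and turns the Hessian into
  \<open>hess_form\<close>.\<close>

lemma hessian_local_max_iff_hess_form:
  assumes no: "\<And>p. \<not> eigpair (-1) p"
  shows "hessian_local_max B (real \<Delta>) \<alpha> \<beta> \<longleftrightarrow> (\<forall>p\<in>centered. p \<noteq> 0 \<longrightarrow> hess_form (real \<Delta>) p < 0)"
proof -
  interpret E: exp_family "UNIV :: ('q \<times> 'q) set" "\<lambda>k. B $ fst k $ snd k" incidence skew_dir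
  proof
    show "v = 0" if van: "\<And>k. k \<in> UNIV \<Longrightarrow> B $ fst k $ snd k \<noteq> 0 \<Longrightarrow> incidence k \<bullet> v = 0" and "skew_dir \<bullet> v = 0" for v
      using no van[of "(_, _)"] that(2) by (intro separating_if_no_eigpair_minus_one) auto
  qed (auto simp: B_nonneg)
  \<comment> \<open>Shifting the halves by \<open>t\<close> and \<open>- t\<close> preserves all
    edge sums. This \<open>t\<close> makes the penalty vanish at \<open>p0\<close>, so the gradient
    there is exactly the pair of marginals.\<close>
  define t where "t = ((\<Sum>j\<in>UNIV. ln (c $ j)) - (\<Sum>i\<in>UNIV. ln (r $ i) - ln Z)) / (2 * real CARD('q))"
  define p0 :: "(real^'q) \<times> (real^'q)" where "p0 = (\<chi> i. ln (r $ i) - ln Z + t, \<chi> j. ln (c $ j) - t)"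
  have skew_p0: "skew_dir \<bullet> p0 = 0"
  proof -
    have "t * (2 * real CARD('q)) = (\<Sum>j\<in>UNIV. ln (c $ j)) - (\<Sum>i\<in>UNIV. ln (r $ i) - ln Z)"
      by (simp add: t_def)
    then show ?thesis
      by (simp add: inner_skew_dir p0_def sum.distrib sum_subtractf algebra_simps)
  qed
  have weight: "B $ fst k $ snd k * exp (incidence k \<bullet> p0) = X $ fst k $ snd k" for k
  proof -
    have "exp (incidence k \<bullet> p0) = exp (ln (r $ fst k)) * exp (ln (c $ snd k)) / exp (ln Z)"
      by (simp add: inner_incidence p0_def flip: exp_add exp_diff)
    then show ?thesis
      using r_pos c_pos Z_pos by (simp add: X_def)
  qed
  have grad_p0: "E.grad p0 = (\<alpha>, \<beta>)"
    unfolding E.grad_def sum_incidence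
    by (simp add: skew_p0 weight[of "(_, _)", simplified] row_sum col_sum vec_eq_iff)
  have hess_p0: "E.hess p0 v = diag v + cross v + (skew_dir \<bullet> v) *\<^sub>R skew_dir" for v
    unfolding E.hess_def diag_cross_eq by (simp add: weight)
  define y0 where "y0 = (\<alpha>, \<beta>)"
  have y0: "y0 \<in> range E.grad" "E.grad_inv y0 = p0"
    unfolding y0_def grad_p0[symmetric] by simp_all
  obtain \<epsilon> where \<epsilon>: "\<epsilon> > 0" and ball: "ball y0 \<epsilon> \<subseteq> range E.grad"
    using E.open_range_grad y0(1) by (meson open_contains_ball)
  have near: "y0 + h \<in> range E.grad" if "norm h < \<epsilon>" for h
    using subsetD[OF ball, of "y0 + h"] that by (simp add: dist_norm)

  \<comment> \<open>The penalty adds \<open>skew_dir \<bullet> p\<close> to every row sum and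
    subtracts it from every column sum. Both families total 1, so it vanishes and the Gibbs weights
    have the perturbed marginals.\<close>
  have dual: "\<exists>p. y0 + h = E.grad p \<and> skew_dir \<bullet> p = 0
      \<and> (\<forall>i. (\<Sum>j\<in>UNIV. B $ i $ j * exp (fst p $ i + snd p $ j)) = fst (y0 + h) $ i)
      \<and> (\<forall>j. (\<Sum>i\<in>UNIV. B $ i $ j * exp (fst p $ i + snd p $ j)) = snd (y0 + h) $ j)"
    if h: "h \<in> constr_dirs" "norm h < \<epsilon>" for h
  proof -
    obtain p where p: "y0 + h = E.grad p"
      using near[OF h(2)] by blast
    let ?x = "\<lambda>i j. B $ i $ j * exp (fst p $ i + snd p $ j)"
    have row: "fst (y0 + h) $ i = (\<Sum>j\<in>UNIV. ?x i j) + skew_dir \<bullet> p" for i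
      unfolding p E.grad_def sum_incidence by (simp add: inner_incidence) (simp add: skew_dir_def)
    have col: "snd (y0 + h) $ j = (\<Sum>i\<in>UNIV. ?x i j) - skew_dir \<bullet> p" for j
      unfolding p E.grad_def sum_incidence by (simp add: inner_incidence) (simp add: skew_dir_def)
    have "(\<Sum>i\<in>UNIV. fst (y0 + h) $ i) = 1" "(\<Sum>j\<in>UNIV. snd (y0 + h) $ j) = 1"
      using h(1) by (simp_all add: y0_def constr_dirs_iff sum.distrib sum_\<alpha> sum_\<beta>)
    then have "(\<Sum>i\<in>UNIV. \<Sum>j\<in>UNIV. ?x i j) + real CARD('q) * (skew_dir \<bullet> p)
        = (\<Sum>j\<in>UNIV. \<Sum>i\<in>UNIV. ?x i j) - real CARD('q) * (skew_dir \<bullet> p)"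
      unfolding row col by (simp add: sum.distrib sum_subtractf)
    moreover have "(\<Sum>i\<in>UNIV. \<Sum>j\<in>UNIV. ?x i j) = (\<Sum>j\<in>UNIV. \<Sum>i\<in>UNIV. ?x i j)"
      by (rule sum.swap)
    ultimately have "skew_dir \<bullet> p = 0"
      by simp
    then show ?thesis
      using p row col by (intro exI[of _ p]) auto
  qed
  have pos: "fst (y0 + h) $ i > 0" "snd (y0 + h) $ i > 0" if h: "h \<in> constr_dirs" "norm h < \<epsilon>" for h i
  proof -
    obtain p where row: "\<forall>i. (\<Sum>j\<in>UNIV. B $ i $ j * exp (fst p $ i + snd p $ j)) = fst (y0 + h) $ i"
      and col: "\<forall>j. (\<Sum>k\<in>UNIV. B $ k $ j * exp (fst p $ k + snd p $ j)) = snd (y0 + h) $ j"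
      using dual[OF h] by blast
    have "\<exists>j. B $ i $ j > 0"
    proof (rule ccontr)
      assume "\<not> ?thesis"
      then have "B $ i $ j = 0" for j
        using B_nonneg[of i j] by (simp add: not_less antisym)
      then have "(\<Sum>j\<in>UNIV. X $ i $ j) = 0"
        by (simp add: X_def)
      then show False
        using \<alpha>_pos[of i] unfolding row_sum by simp
    qed
    then obtain j where j: "B $ i $ j > 0" ..
    have "(\<Sum>j\<in>UNIV. B $ i $ j * exp (fst p $ i + snd p $ j)) > 0"
      using j B_nonneg by (intro sum_pos2[of _ j]) auto
    then show "fst (y0 + h) $ i > 0"
      unfolding row[rule_format] .
    have "\<exists>k. B $ k $ i > 0"
    proof (rule ccontr)
      assume "\<not> ?thesis"
      then have "B $ k $ i = 0" for k
        using B_nonneg[of k i] by (simp add: not_less antisym)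
      then have "(\<Sum>k\<in>UNIV. X $ k $ i) = 0"
        by (simp add: X_def)
      then show False
        using \<beta>_pos[of i] unfolding col_sum by simp
    qed
    then obtain k where k: "B $ k $ i > 0" ..
    have "(\<Sum>k\<in>UNIV. B $ k $ i * exp (fst p $ k + snd p $ i)) > 0"
      using k B_nonneg by (intro sum_pos2[of _ k]) auto
    then show "snd (y0 + h) $ i > 0"
      unfolding col[rule_format] .
  qed

  \<comment> \<open>On the plane \<open>pot\<close> at the dual point is the total mass 1, so
    \<open>conj_pot\<close> plus 1 is the pairing in \<open>Psi1_gibbs\<close>.\<close>
  define g where "g h = (real \<Delta> - 1) * ((\<Sum>i\<in>UNIV. xlnx (fst (y0 + h) $ i)) + (\<Sum>j\<in>UNIV. xlnx (snd (y0 + h) $ j)))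
      - real \<Delta> * (E.conj_pot (y0 + h) + 1)" for h
  define G where "G h = (\<chi> i. (real \<Delta> - 1) * (ln (fst (y0 + h) $ i) + 1),
      \<chi> j. (real \<Delta> - 1) * (ln (snd (y0 + h) $ j) + 1)) - real \<Delta> *\<^sub>R E.grad_inv (y0 + h)" for h
  define H where "H v = (\<chi> i. (real \<Delta> - 1) * (fst v $ i / \<alpha> $ i), \<chi> j. (real \<Delta> - 1) * (snd v $ j / \<beta> $ j))
      - real \<Delta> *\<^sub>R E.hess_inv p0 v" for v
  have val: "Psi1 B (real \<Delta>) (\<alpha> + fst h) (\<beta> + snd h) = ereal (g h)"
    if h: "h \<in> constr_dirs" "norm h < \<epsilon>" for h
  proof -
    obtain p where p: "y0 + h = E.grad p" "skew_dir \<bullet> p = 0"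
      and row: "\<forall>i. (\<Sum>j\<in>UNIV. B $ i $ j * exp (fst p $ i + snd p $ j)) = fst (y0 + h) $ i"
      and col: "\<forall>j. (\<Sum>i\<in>UNIV. B $ i $ j * exp (fst p $ i + snd p $ j)) = snd (y0 + h) $ j"
      using dual[OF h] by blast
    have "(\<Sum>k\<in>UNIV. B $ fst k $ snd k * exp (incidence k \<bullet> p))
        = (\<Sum>i\<in>UNIV. \<Sum>j\<in>UNIV. B $ i $ j * exp (fst p $ i + snd p $ j))"
      by (simp add: sum.cartesian_product' inner_incidence flip: UNIV_Times_UNIV)
    also have "\<dots> = 1"
      unfolding row[rule_format] using h(1) by (simp add: y0_def constr_dirs_iff sum.distrib sum_\<alpha>)
    finally have "E.pot p = 1"
      by (simp add: E.pot_def p(2))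
    then have "E.conj_pot (y0 + h) + 1 = fst (y0 + h) \<bullet> fst p + snd (y0 + h) \<bullet> snd p"
      by (simp add: E.conj_pot_def p(1) inner_prod_def)
    then have "Psi1 B (real \<Delta>) (fst (y0 + h)) (snd (y0 + h)) = ereal (g h)"
      unfolding g_def
      by (simp only:) (rule Psi1_gibbs[where x = "\<chi> i j. B $ i $ j * exp (fst p $ i + snd p $ j)"],
          use B_nonneg row col in auto)
    then show ?thesis
      by (simp add: y0_def)
  qed
  have der: "(g has_derivative (\<lambda>v. G h \<bullet> v)) (at h within constr_dirs)"
    if h: "h \<in> constr_dirs" "norm h < \<epsilon>" for h
  proof -
    have x: "((\<lambda>h. xlnx (f (y0 + h) $ i)) has_derivative (\<lambda>v. (ln (f (y0 + h) $ i) + 1) * f v $ i)) (at h)"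
      if f: "bounded_linear f" and pos: "f (y0 + h) $ i > 0" for f :: "_ \<Rightarrow> real^'q" and i
    proof -
      have "((\<lambda>h. f (y0 + h) $ i) has_derivative (\<lambda>v. f v $ i)) (at h)"
        by (rule bounded_linear.has_derivative[OF bounded_linear_compose[OF bounded_linear_vec_nth f]])
          (auto intro!: derivative_eq_intros)
      from DERIV_compose_FDERIV[OF DERIV_xlnx[OF pos] this] show ?thesis
        by (simp add: mult.commute)
    qed
    have "((\<lambda>h. y0 + h) has_derivative (\<lambda>v. v)) (at h)"
      by (auto intro!: derivative_eq_intros)
    from has_derivative_compose[OF this E.has_derivative_conj_pot[OF near[OF h(2)]]]
    have "((\<lambda>h. E.conj_pot (y0 + h)) has_derivative (\<lambda>v. E.grad_inv (y0 + h) \<bullet> v)) (at h)" .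
    then have "(g has_derivative (\<lambda>v. (real \<Delta> - 1) * ((\<Sum>i\<in>UNIV. (ln (fst (y0 + h) $ i) + 1) * fst v $ i)
        + (\<Sum>j\<in>UNIV. (ln (snd (y0 + h) $ j) + 1) * snd v $ j)) - real \<Delta> * (E.grad_inv (y0 + h) \<bullet> v + 0))) (at h)"
      unfolding g_def[abs_def]
      by (intro has_derivative_diff has_derivative_mult_right has_derivative_add has_derivative_sum
          has_derivative_const x bounded_linear_fst bounded_linear_snd pos h)
    moreover have "(real \<Delta> - 1) * ((\<Sum>i\<in>UNIV. (ln (fst (y0 + h) $ i) + 1) * fst v $ i)
        + (\<Sum>j\<in>UNIV. (ln (snd (y0 + h) $ j) + 1) * snd v $ j)) - real \<Delta> * (E.grad_inv (y0 + h) \<bullet> v + 0) = G h \<bullet> v" for v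
      unfolding G_def inner_diff_left inner_scaleR_left
      by (simp add: inner_prod_def[of "(_, _)"] inner_vec_def sum_distrib_left algebra_simps sum.distrib
          sum_subtractf)
    ultimately show ?thesis
      by (simp only: has_derivative_at_withinI)
  qed
  have der2: "(G has_derivative H) (at 0 within constr_dirs)"
  proof -
    have x: "((\<lambda>h. \<chi> i. (real \<Delta> - 1) * (ln (f (y0 + h) $ i) + 1)) has_derivative
        (\<lambda>v. \<chi> i. (real \<Delta> - 1) * (f v $ i / f y0 $ i))) (at 0)"
      if f: "bounded_linear f" and pos: "\<And>i. f y0 $ i > 0" for f :: "_ \<Rightarrow> real^'q"
    proof (rule has_derivative_vecI)
      fix i
      have "((\<lambda>h. f (y0 + h) $ i) has_derivative (\<lambda>v. f v $ i)) (at 0)"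
        by (rule bounded_linear.has_derivative[OF bounded_linear_compose[OF bounded_linear_vec_nth f]])
          (auto intro!: derivative_eq_intros)
      moreover have "((\<lambda>x. (real \<Delta> - 1) * (ln x + 1)) has_real_derivative (real \<Delta> - 1) / f y0 $ i)
          (at (f (y0 + 0) $ i))"
        using pos[of i] by (auto intro!: derivative_eq_intros)
      ultimately show "((\<lambda>h. (\<chi> i. (real \<Delta> - 1) * (ln (f (y0 + h) $ i) + 1)) $ i) has_derivative
          (\<lambda>v. (\<chi> i. (real \<Delta> - 1) * (f v $ i / f y0 $ i)) $ i)) (at 0)"
        using DERIV_compose_FDERIV[of "\<lambda>x. (real \<Delta> - 1) * (ln x + 1)"]
        by (fastforce simp: mult.commute)
    qed
    have "((\<lambda>h. y0 + h) has_derivative (\<lambda>v. v)) (at 0)"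
      by (auto intro!: derivative_eq_intros)
    moreover have "(E.grad_inv has_derivative E.hess_inv p0) (at (y0 + 0))"
      using E.has_derivative_grad_inv[of p0] by (simp add: grad_p0 y0_def)
    ultimately have "((\<lambda>h. E.grad_inv (y0 + h)) has_derivative E.hess_inv p0) (at 0)"
      by (rule has_derivative_compose)
    then have "(G has_derivative H) (at 0)"
      unfolding G_def[abs_def] H_def[abs_def]
      using x[OF bounded_linear_fst] x[OF bounded_linear_snd] \<alpha>_pos \<beta>_pos
      by (intro has_derivative_diff has_derivative_Pair has_derivative_scaleR_right) (auto simp: y0_def)
    then show ?thesis
      by (rule has_derivative_at_withinI)
  qed
  have crit: "G 0 \<bullet> v = 0" if v: "v \<in> constr_dirs" for v
  proof -
    have ln_pow: "(real \<Delta> - 1) * ln x = ln (x ^ (\<Delta> - 1))" if "x > 0" for x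
      using that \<Delta>_ge by (simp add: ln_realpow)
    \<comment> \<open>Taking logarithms in the fixpoint equation cancels all dependence on
      \<open>i\<close>. The gradient is thus a constant pair, orthogonal to the plane
      directions.\<close>
    have a: "(real \<Delta> - 1) * (ln (\<alpha> $ i) + 1) - real \<Delta> * (ln (r $ i) - ln Z + t)
        = real \<Delta> - 1 + ln k1 + ln Z - real \<Delta> * t" for i
    proof -
      have "(real \<Delta> - 1) * ln ((B *v c) $ i) = ln k1 + ln (r $ i)"
        using k1_pos r_pos[of i] Bc_pos[of i] by (simp only: ln_pow fix_r ln_mult_pos)
      moreover have eq: "ln (\<alpha> $ i) = ln (r $ i) + ln ((B *v c) $ i) - ln Z"
        using r_pos[of i] Bc_pos[of i] Z_pos by (simp add: \<alpha>_def ln_div ln_mult_pos)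
      ultimately show ?thesis
        unfolding eq by (simp add: algebra_simps)
    qed
    have b: "(real \<Delta> - 1) * (ln (\<beta> $ i) + 1) - real \<Delta> * (ln (c $ i) - t)
        = (real \<Delta> - 1) * (1 - ln Z) + ln k2 + real \<Delta> * t" for i
    proof -
      have "(real \<Delta> - 1) * ln ((transpose B *v r) $ i) = ln k2 + ln (c $ i)"
        using k2_pos c_pos[of i] Br_pos[of i] by (simp only: ln_pow fix_c ln_mult_pos)
      moreover have eq: "ln (\<beta> $ i) = ln (c $ i) + ln ((transpose B *v r) $ i) - ln Z"
        using c_pos[of i] Br_pos[of i] Z_pos
        by (simp add: \<beta>_def ln_div ln_mult_pos del: transpose_matrix_vector)
      ultimately show ?thesis
        unfolding eq by (simp add: algebra_simps)
    qed
    have "G 0 = (vec (real \<Delta> - 1 + ln k1 + ln Z - real \<Delta> * t),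
        vec ((real \<Delta> - 1) * (1 - ln Z) + ln k2 + real \<Delta> * t))"
      using a b by (simp add: G_def y0(2) p0_def prod_eq_iff vec_eq_iff) (simp add: y0_def)
    then show ?thesis
      using inner_const_constr_dirs[OF v] by simp
  qed

  have form: "H (diag p + cross p) \<bullet> (diag p + cross p) = hess_form (real \<Delta>) p"
    and in_dirs: "diag p + cross p \<in> constr_dirs" and nonzero: "p \<noteq> 0 \<Longrightarrow> diag p + cross p \<noteq> 0"
    if p: "p \<in> centered" for p
  proof -
    have sums: "(\<Sum>i\<in>UNIV. fst (diag p + cross p) $ i) = 0" "(\<Sum>j\<in>UNIV. snd (diag p + cross p) $ j) = 0"
      using p \<alpha>_cond[of "snd p"] \<beta>_cond[of "fst p"]
      by (simp_all add: centered_def diag_def cross_def sum.distrib inner_vec_def)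
    then show dirs: "diag p + cross p \<in> constr_dirs"
      by (simp add: constr_dirs_iff)
    define s where "s = (skew_dir \<bullet> p) / (2 * real CARD('q))"
    have gg: "skew_dir \<bullet> (skew_dir :: (real^'q) \<times> (real^'q)) = 2 * real CARD('q)"
      by (simp add: skew_dir_def inner_prod_def inner_vec_def)
    \<comment> \<open>\<open>A + T\<close> kills \<open>skew_dir\<close>, so removing that component
      keeps \<open>A p + T p\<close> and removes the penalty: \<open>p'\<close> is the preimage
      under the Hessian.\<close>
    define p' where "p' = p - s *\<^sub>R skew_dir"
    have g': "skew_dir \<bullet> p' = 0"
      by (simp add: p'_def inner_diff_right gg s_def)
    have ng: "diag skew_dir + cross skew_dir = 0"
      unfolding diag_cross_eq by (simp add: inner_incidence skew_dir_def)
    have "diag p' + cross p' = diag p + cross p - s *\<^sub>R (diag skew_dir + cross skew_dir)"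
      by (simp add: p'_def linear_diff[OF linear_A] linear_diff[OF linear_T]
          linear_scale[OF linear_A] linear_scale[OF linear_T] scaleR_right_distrib)
    then have "E.hess p0 p' = diag p + cross p"
      by (simp add: hess_p0 g' ng)
    then have inv: "E.hess_inv p0 (diag p + cross p) = p'"
      using E.hess_inv_hess[of p0 p'] by simp
    have "skew_dir \<bullet> (diag p + cross p) = 0"
      unfolding inner_skew_dir sums by simp
    then have "p' \<bullet> (diag p + cross p) = p \<bullet> (diag p + cross p)"
      by (simp add: p'_def inner_diff_left)
    moreover have "(\<chi> i. (real \<Delta> - 1) * (fst (diag p + cross p) $ i / \<alpha> $ i),
        \<chi> j. (real \<Delta> - 1) * (snd (diag p + cross p) $ j / \<beta> $ j)) = (real \<Delta> - 1) *\<^sub>R (p + cond p)"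
      using \<alpha>_pos \<beta>_pos
      by (simp add: diag_def cross_def cond_def prod_eq_iff vec_eq_iff add_divide_distrib less_imp_neq[symmetric])
    ultimately show "H (diag p + cross p) \<bullet> (diag p + cross p) = hess_form (real \<Delta>) p"
      by (simp only: H_def inv inner_diff_left inner_scaleR_left hess_form_def)
    show "diag p + cross p \<noteq> 0" if "p \<noteq> 0"
      using no[of p] p that by (auto simp: eigpair_def eq_neg_iff_add_eq_0 add.commute)
  qed
  have onto: "\<exists>p\<in>centered. v = diag p + cross p" if v: "v \<in> constr_dirs" for v
  proof -
    \<comment> \<open>Zero row and column totals of \<open>v\<close> make the penalty of
      \<open>q\<close> vanish and its two means opposite. A multiple of the kernel vector
      \<open>skew_dir\<close> then moves \<open>q\<close> into \<open>centered\<close>.\<close>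
    define q where "q = E.hess_inv p0 v"
    have eq: "diag q + cross q + (skew_dir \<bullet> q) *\<^sub>R skew_dir = v"
      using E.hess_hess_inv[of p0 v] unfolding hess_p0 q_def .
    have fsum: "(\<Sum>i\<in>UNIV. fst (diag q + cross q + d *\<^sub>R skew_dir) $ i) = \<alpha> \<bullet> fst q + \<beta> \<bullet> snd q + d * real CARD('q)"
      and ssum: "(\<Sum>i\<in>UNIV. snd (diag q + cross q + d *\<^sub>R skew_dir) $ i) = \<alpha> \<bullet> fst q + \<beta> \<bullet> snd q - d * real CARD('q)" for d
      using \<alpha>_cond[of "snd q"] \<beta>_cond[of "fst q"]
      by (simp_all add: diag_def cross_def skew_dir_def sum.distrib sum_subtractf inner_vec_def)
    have "\<alpha> \<bullet> fst q + \<beta> \<bullet> snd q + (skew_dir \<bullet> q) * real CARD('q) = 0"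
      "\<alpha> \<bullet> fst q + \<beta> \<bullet> snd q - (skew_dir \<bullet> q) * real CARD('q) = 0"
      using v[unfolded constr_dirs_iff] fsum[of "skew_dir \<bullet> q", unfolded eq] ssum[of "skew_dir \<bullet> q", unfolded eq]
      by linarith+
    then have bal: "\<beta> \<bullet> snd q = - (\<alpha> \<bullet> fst q)" and "(skew_dir \<bullet> q) * real CARD('q) = 0"
      by linarith+
    then have v': "v = diag q + cross q"
      using eq by simp
    define p where "p = q - (\<alpha> \<bullet> fst q) *\<^sub>R skew_dir"
    have "p = center q"
      by (simp add: p_def center_def skew_dir_def bal prod_eq_iff vec_eq_iff)
    moreover have "diag p + cross p = diag q + cross q - (\<alpha> \<bullet> fst q) *\<^sub>R (diag skew_dir + cross skew_dir)"
      by (simp add: p_def linear_diff[OF linear_A] linear_diff[OF linear_T]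
          linear_scale[OF linear_A] linear_scale[OF linear_T] scaleR_right_distrib)
    moreover have "diag skew_dir + cross skew_dir = 0"
      unfolding diag_cross_eq by (simp add: inner_incidence skew_dir_def)
    ultimately show ?thesis
      using center_in_centered[of q] v' by (intro bexI[of _ p]) auto
  qed
  have zero: "diag 0 + cross 0 = 0"
    by (simp add: linear_0[OF linear_A] linear_0[OF linear_T])
  have "hessian_local_max B (real \<Delta>) \<alpha> \<beta> \<longleftrightarrow> (\<forall>v\<in>constr_dirs. v \<noteq> 0 \<longrightarrow> H v \<bullet> v < 0)"
    by (rule hessian_local_max_iff[OF \<epsilon> val der der2 crit])
  also have "\<dots> \<longleftrightarrow> (\<forall>p\<in>centered. p \<noteq> 0 \<longrightarrow> hess_form (real \<Delta>) p < 0)"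
  proof (intro iffI ballI impI)
    fix p assume "\<forall>v\<in>constr_dirs. v \<noteq> 0 \<longrightarrow> H v \<bullet> v < 0" and p: "p \<in> centered" "p \<noteq> 0"
    then have "H (diag p + cross p) \<bullet> (diag p + cross p) < 0"
      using in_dirs[OF p(1)] nonzero[OF p] by blast
    then show "hess_form (real \<Delta>) p < 0"
      unfolding form[OF p(1)] .
  next
    fix v :: "(real^'q) \<times> (real^'q)"
    assume neg: "\<forall>p\<in>centered. p \<noteq> 0 \<longrightarrow> hess_form (real \<Delta>) p < 0" and v: "v \<in> constr_dirs" "v \<noteq> 0"
    obtain p where p: "p \<in> centered" "v = diag p + cross p"
      using onto[OF v(1)] by blast
    then have "p \<noteq> 0"
      using v(2) zero by blast
    then show "H v \<bullet> v < 0"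
      unfolding p(2) form[OF p(1)] using neg p(1) by blast
  qed
  finally show ?thesis .
qed

text \<open>If -1 is an eigenvalue, attractiveness fails as \<open>\<Delta> - 1 \<ge> 2\<close>, and
  so does the Hessian property, \<open>Psi1\<close> not being finite throughout any neighbourhood in
  the plane. Otherwise both equal the eigenvalue condition.\<close>

lemma jacobian_attractive_iff_hessian_local_max:
  "jacobian_attractive B \<Delta> r c \<longleftrightarrow> hessian_local_max B (real \<Delta>) \<alpha> \<beta>"
proof (cases "\<exists>p. eigpair (-1) p")
  case True
  then have "\<not> (\<forall>k p. eigpair k p \<longrightarrow> \<bar>k\<bar> * (real \<Delta> - 1) < 1)"
    using \<Delta>_ge by force
  then show ?thesis
    using True not_hessian_local_max_if_eigpair_minus_one jacobian_attractive_iff by blast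
next
  case False
  have "real \<Delta> \<ge> 2"
    using \<Delta>_ge by simp
  then show ?thesis
    using False hessian_local_max_iff_hess_form jacobian_attractive_iff eigenvalues_iff_hess_form_neg
    by blast
qed

end

section \<open>The correspondence\<close>

text \<open>The hypothesis makes \<open>s\<close> proportional to \<open>R\<close> to the power
  \<open>1 / (\<Delta> - 1)\<close>. Hence \<open>R\<close> to the power
  \<open>\<Delta> / (\<Delta> - 1)\<close> is proportional to \<open>R s\<close>, and the constant
  cancels on normalising.\<close>

lemma corr_vec_eq:
  fixes R s :: "real^'q"
  assumes \<Delta>: "\<Delta> \<ge> 2" and R: "\<And>i. R $ i > 0" and s: "\<And>i. s $ i > 0"
    and \<kappa>: "\<kappa> > 0" and pow: "\<And>i. s $ i ^ (\<Delta> - 1) = \<kappa> * R $ i"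
  shows "corr_vec \<Delta> R = (\<chi> i. R $ i * s $ i / (\<Sum>i\<in>UNIV. R $ i * s $ i))"
proof -
  define m where "m = real \<Delta> - 1"
  have m: "m > 0" "real (\<Delta> - 1) = m"
    using \<Delta> by (simp_all add: m_def)
  define d where "d = \<kappa> powr (1 / m)"
  have d: "d > 0"
    using \<kappa> by (simp add: d_def)
  have "R $ i powr (real \<Delta> / (real \<Delta> - 1)) = R $ i * s $ i / d" for i
  proof -
    have "s $ i = (s $ i powr m) powr (1 / m)"
      using m(1) s[of i] by (simp add: powr_powr)
    also have "s $ i powr m = \<kappa> * R $ i"
      using s[of i] by (simp add: powr_realpow flip: pow m(2))
    finally have "s $ i = d * R $ i powr (1 / m)"
      using \<kappa> R[of i] by (simp add: powr_mult d_def)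
    moreover have "real \<Delta> / (real \<Delta> - 1) = 1 + 1 / m"
      using m(1) by (simp add: m_def field_simps)
    ultimately show ?thesis
      using R[of i] d by (simp add: powr_add)
  qed
  then show ?thesis
    using d by (simp add: corr_vec_def flip: sum_divide_distrib)
qed

theorem theorem7:
  fixes B :: "real^'q^'q" and \<Delta> :: nat and R C :: "real^'q"
  assumes "nonneg_sym_mat B"
    and "irreducible_mat B"
    and "\<Delta> \<ge> 3"
    and "\<forall>i. R$i > 0" and "\<forall>j. C$j > 0"
    and "is_fixpoint B \<Delta> R C"
  shows "jacobian_attractive B \<Delta> R C \<longleftrightarrow>
         hessian_local_max B (real \<Delta>) (corr_vec \<Delta> R) (corr_vec \<Delta> C)"
proof -
  define \<rho> \<gamma> where "\<rho> = (\<Sum>i\<in>UNIV. R $ i)" and "\<gamma> = (\<Sum>j\<in>UNIV. C $ j)"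
  have pos: "\<rho> > 0" "\<gamma> > 0"
    unfolding \<rho>_def \<gamma>_def using assms(4,5) by (auto intro: sum_pos)
  define r c where "r = normalize_vec R" and "c = normalize_vec C"
  have comp: "r $ i = R $ i / \<rho>" "c $ i = C $ i / \<gamma>" for i
    by (simp_all add: r_def c_def normalize_vec_def \<rho>_def \<gamma>_def)
  have sums: "(\<Sum>i\<in>UNIV. r $ i) = 1" "(\<Sum>i\<in>UNIV. c $ i) = 1"
    using pos by (simp_all add: comp flip: sum_divide_distrib) (simp_all add: \<rho>_def \<gamma>_def)
  obtain k l where k: "k > 0" "fst (tree_rec B \<Delta> (R, C)) = k *\<^sub>R R"
    and l: "l > 0" "snd (tree_rec B \<Delta> (R, C)) = l *\<^sub>R C"
    using assms(6) by (auto simp: is_fixpoint_def)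
  have Bc: "(B *v c) $ i = (\<Sum>j\<in>UNIV. B $ i $ j * C $ j) / \<gamma>"
    and Br: "(transpose B *v r) $ i = (\<Sum>j\<in>UNIV. B $ j $ i * R $ j) / \<rho>" for i
    by (simp_all add: matrix_vector_mult_def transpose_def comp sum_divide_distrib
        del: transpose_matrix_vector)
  \<comment> \<open>Normalised vectors on the left and the original ones on the right: the form that
    \<open>corr_vec_eq\<close> takes for the original \<open>R\<close> and \<open>C\<close>.\<close>
  have fix_R: "(B *v c) $ i ^ (\<Delta> - 1) = k / \<gamma> ^ (\<Delta> - 1) * R $ i"
    and fix_C: "(transpose B *v r) $ i ^ (\<Delta> - 1) = l / \<rho> ^ (\<Delta> - 1) * C $ i" for i
    using arg_cong[OF k(2), of "\<lambda>v. v $ i"] arg_cong[OF l(2), of "\<lambda>v. v $ i"]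
    unfolding Bc Br by (simp_all add: tree_rec_def power_divide)
  interpret tree_fixpoint B \<Delta> r c "k * \<rho> / \<gamma> ^ (\<Delta> - 1)" "l * \<gamma> / \<rho> ^ (\<Delta> - 1)"
  proof
    show "(B *v c) $ i ^ (\<Delta> - 1) = k * \<rho> / \<gamma> ^ (\<Delta> - 1) * r $ i"
      "(transpose B *v r) $ i ^ (\<Delta> - 1) = l * \<gamma> / \<rho> ^ (\<Delta> - 1) * c $ i" for i
      unfolding fix_R fix_C using pos by (simp_all add: comp)
  qed (use assms pos sums k(1) l(1) in \<open>auto simp: nonneg_sym_mat_def comp\<close>)
  have "corr_vec \<Delta> R = (\<chi> i. R $ i * (B *v c) $ i / (\<Sum>i\<in>UNIV. R $ i * (B *v c) $ i))"
    using assms k(1) pos by (intro corr_vec_eq[OF _ _ Bc_pos _ fix_R]) auto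
  also have "\<dots> = \<alpha>"
    using pos by (simp add: \<alpha>_def Z_def comp flip: sum_divide_distrib)
  finally have \<alpha>: "corr_vec \<Delta> R = \<alpha>" .
  have "corr_vec \<Delta> C = (\<chi> i. C $ i * (transpose B *v r) $ i / (\<Sum>i\<in>UNIV. C $ i * (transpose B *v r) $ i))"
    using assms l(1) pos by (intro corr_vec_eq[OF _ _ Br_pos _ fix_C]) auto
  also have "\<dots> = \<beta>"
  proof -
    \<comment> \<open>\<open>Z\<close> was defined by the row sum; that the column sum agrees
      follows from \<open>\<beta>\<close> having total mass 1.\<close>
    have "Z = (\<Sum>j\<in>UNIV. c $ j * (transpose B *v r) $ j)"
      using sum_\<beta> Z_pos by (simp add: \<beta>_def flip: sum_divide_distrib)
    then show ?thesis
      using pos by (simp add: \<beta>_def comp flip: sum_divide_distrib)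
  qed
  finally have \<beta>: "corr_vec \<Delta> C = \<beta>" .
  have "normalize_vec r = r" "normalize_vec c = c"
    by (simp_all add: normalize_vec_def sums)
  then have "jacobian_attractive B \<Delta> R C \<longleftrightarrow> jacobian_attractive B \<Delta> r c"
    by (simp add: jacobian_attractive_def flip: r_def c_def)
  then show ?thesis
    unfolding \<alpha> \<beta> using jacobian_attractive_iff_hessian_local_max by simp
qed

end
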